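(* Suppose that $\mathcal T=(V,E)$ is a directed tree for which there exists $\omega\in V$ such that $\operatorname{card}(\operatorname{Chi}(\omega))\ge2$ and $\operatorname{card}(\operatorname{Chi}(v))=1$ for every $v\in V\setminus\{\omega\}$. Let $S_{\boldsymbol\lambda}\in\boldsymbol B(\ell^2(V))$ be a weighted shift on $\mathcal T$ with nonzero weights $\boldsymbol\lambda=\{\lambda_v\}_{v\in V^\circ}$. Then the following assertions hold. (i) If $\omega=\mathrm{root}$, then $S_{\boldsymbol\lambda}$ is completely hyperexpansive if and only if the sequence $\{\|S_{\boldsymbol\lambda}^ne_v\|^2\}_{n=0}^\infty$ is completely alternating for every $v\in\operatorname{Chi}(\omega)$, and $$\sum_{v\in\operatorname{Chi}(\omega)}|\lambda_v|^2\ge1+\sum_{v\in\operatorname{Chi}(\omega)}|\lambda_v|^2\int_0^1\frac1s\,d\tau_v(s).$$ (ii) If $\mathcal T$ has a root and $\omega\ne\mathrm{root}$, then $S_{\boldsymbol\lambda}$ is completely hyperexpansive if and only if one of the following two equivalent conditions holds: (ii-a) $S_{\boldsymbol\lambda_\rightarrow(\omega)}$ is completely hyperexpansive, $$\sum_{v\in\operatorname{Chi}(\omega)}|\lambda_v|^2=1+\sum_{v\in\operatorname{Chi}(\omega)}|\lambda_v|^2\int_0^1\frac1s\,d\tau_v(s),$$ $$|\lambda_{\operatorname{par}^{k-1}(\omega)}|^2=1+\Big|\prod_{j=0}^{k-1}\lambda_{\operatorname{par}^j(\omega)}\Big|^2\sum_{v\in\operatorname{Chi}(\omega)}|\lambda_v|^2\int_0^1\frac1{s^{k+1}}\,d\tau_v(s)$$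 for all integers $k$ with $1\le k\le\kappa-1$, and $$|\lambda_{\operatorname{par}^{\kappa-1}(\omega)}|^2\ge1+\Big|\prod_{j=0}^{\kappa-1}\lambda_{\operatorname{par}^j(\omega)}\Big|^2\sum_{v\in\operatorname{Chi}(\omega)}|\lambda_v|^2\int_0^1\frac1{s^{\kappa+1}}\,d\tau_v(s),$$ where $\kappa$ is the unique positive integer such that $\operatorname{par}^\kappa(\omega)=\mathrm{root}$; (ii-b) the sequences $\{\|S_{\boldsymbol\lambda}^ne_{\mathrm{root}}\|^2\}_{n=0}^\infty$ and $\{\|S_{\boldsymbol\lambda}^ne_v\|^2\}_{n=0}^\infty$ are completely alternating for all $v\in\operatorname{Chi}(\omega)$. (iii) If $\mathcal T$ is rootless, then $S_{\boldsymbol\lambda}$ is completely hyperexpansive if and only if $S_{\boldsymbol\lambda}$ is an isometry.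
   Context: A directed tree $\mathcal T=(V,E)$ consists of a nonempty set $V$ (of arbitrary cardinality) of vertices and a set $E\subseteq V\times V\setminus\{(v,v):v\in V\}$ of edges such that: (1) any two distinct vertices $u,v$ are joined by an undirected path, i.e. there are $v_1=u,\dots,v_n=v$ in $V$ ($n\ge 2$) with $(v_j,v_{j+1})\in E$ or $(v_{j+1},v_j)\in E$ for each $j<n$; (2) there is no circuit, i.e. no finite sequence of distinct vertices $u_1,\dots,u_n$ ($n\ge2$) with $(u_j,u_{j+1})\in E$ for $j<n$ and $(u_n,u_1)\in E$; (3) every vertex $v$ that is not a root has a unique vertex $\operatorname{par}(v)$ (its parent) with $(\operatorname{par}(v),v)\in E$; a root is a vertex $v$ for which there is no $u$ with $(u,v)\in E$. A directed tree has at most one root, denoted $\mathrm{root}$ when it exists; it is rootless if there is none. $V^\circ$ is $V$ with the root removed (and $V^\circ=V$ if $\mathcal T$ is rootless). $\operatorname{Chi}(u)=\{v\in V:(u,v)\in E\}$. $\operatorname{par}^j$ is the $j$-fold composition of $\operatorname{par}$, $\operatorname{par}^0$ being the identity. $\operatorname{Des}(u)$ is the set of $v\in V$ with $\operatorname{par}^n(v)=u$ for some $n\ge0$; $\mathcal T_{\operatorname{Des}(u)}=(\operatorname{Des}(u),E\cap(\operatorname{Des}(u)\times\operatorname{Des}(u)))$ is a directed tree with root $u$. $\ell^2(V)$ is the Hilbert space of square summable complex functions on $V$, with orthonormal basis $\{e_u\}_{u\in V}$, $e_u$ being the indicator function of $\{u\}$. For $\boldsymbol\lambda=\{\lambda_v\}_{v\in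 V^\circ}\subseteq\mathbb C$ and $f\colon V\to\mathbb C$ put $(\Lambda f)(v)=\lambda_v f(\operatorname{par}(v))$ for $v\in V^\circ$ and $(\Lambda f)(\mathrm{root})=0$. The weighted shift $S_{\boldsymbol\lambda}$ is the operator in $\ell^2(V)$ with domain $\{f\in\ell^2(V):\Lambda f\in\ell^2(V)\}$ and $S_{\boldsymbol\lambda}f=\Lambda f$. $S_{\boldsymbol\lambda_\rightarrow(\omega)}$ denotes the weighted shift on $\mathcal T_{\operatorname{Des}(\omega)}$ with weights $\{\lambda_v\}_{v\in\operatorname{Des}(\omega)\setminus\{\omega\}}$; it is the restriction of $S_{\boldsymbol\lambda}$ to $\ell^2(\operatorname{Des}(\omega))$. $\boldsymbol B(\mathcal H)$ denotes the bounded operators on $\mathcal H$ with domain $\mathcal H$. A real sequence $\{a_n\}_{n=0}^\infty$ is completely alternating if $\sum_{j=0}^n(-1)^j\binom nja_{m+j}\le0$ for all integers $m\ge0$, $n\ge1$; equivalently, there is a (unique, finite) positive Borel measure $\tau$ on $[0,1]$, called its representing measure, such that $a_n=a_0+\int_0^1(1+\dots+s^{n-1})\,d\tau(s)$ for $n=1,2,\dots$. $A\in\boldsymbol B(\mathcal H)$ is completely hyperexpansive if $\{\|A^nh\|^2\}_{n=0}^\infty$ is completely alternating for every $h\in\mathcal H$. If $\{\|S_{\boldsymbol\lambda}^ne_w\|^2\}_{n=0}^\infty$ is completely alternating, its representing measure is denoted $\tau_w$. (Complete hyperexpansivity of $S_{\boldsymbol\lambda_\rightarrow(\omega)}$ guarantees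 that $\tau_v$ exists for every $v\in\operatorname{Chi}(\omega)$.) Conventions: $\int_0^1$ means $\int_{[0,1]}$ and $\frac10=\infty$. *)

theory Defs
  imports "HOL-Analysis.Analysis"
begin

definition is_root :: "'a set \<Rightarrow> ('a \<times> 'a) set \<Rightarrow> 'a \<Rightarrow> bool" where
  "is_root V E v \<longleftrightarrow> v \<in> V \<and> (\<nexists>u. (u, v) \<in> E)"

locale directed_tree =
  fixes V :: "'a set" and E :: "('a \<times> 'a) set"
  assumes nonempty: "V \<noteq> {}"
    and edges: "E \<subseteq> V \<times> V - {(v, v) | v. v \<in> V}"
    and connected:
      "\<And>u v. u \<in> V \<Longrightarrow> v \<in> V \<Longrightarrow> u \<noteq> v \<Longrightarrow>
        \<exists>vs. length vs \<ge> 2 \<and> set vs \<subseteq> V \<and> hd vs = u \<and> last vs = v \<and>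
          successively (\<lambda>x y. (x, y) \<in> E \<or> (y, x) \<in> E) vs"
    and no_circuit:
      "\<nexists>us. length us \<ge> 2 \<and> distinct us \<and>
          successively (\<lambda>x y. (x, y) \<in> E) us \<and> (last us, hd us) \<in> E"
    and unique_parent:
      "\<And>v. v \<in> V \<Longrightarrow> \<not> is_root V E v \<Longrightarrow> \<exists>!u. (u, v) \<in> E"

definition has_root :: "'a set \<Rightarrow> ('a \<times> 'a) set \<Rightarrow> bool" where
  "has_root V E \<longleftrightarrow> (\<exists>r. is_root V E r)"

definition tree_root :: "'a set \<Rightarrow> ('a \<times> 'a) set \<Rightarrow> 'a" where
  "tree_root V E = (THE r. is_root V E r)"

definition nonroots :: "'a set \<Rightarrow> ('a \<times> 'a) set \<Rightarrow> 'a set" where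
  "nonroots V E = V - {r. is_root V E r}"

text \<open>The parent function is meaningful only on \<^term>\<open>nonroots V E\<close>; its value elsewhere is
  unspecified.  Hence its \<open>n\<close>-fold composition is meaningful at \<open>v\<close> only if none of the
  first \<open>n\<close> applications starts from the root, and this is recorded by \<open>par_pow_defined\<close>.\<close>

definition par :: "('a \<times> 'a) set \<Rightarrow> 'a \<Rightarrow> 'a" where
  "par E v = (THE u. (u, v) \<in> E)"

definition par_pow_defined :: "'a set \<Rightarrow> ('a \<times> 'a) set \<Rightarrow> nat \<Rightarrow> 'a \<Rightarrow> bool" where
  "par_pow_defined V E n v \<longleftrightarrow> (\<forall>j<n. (par E ^^ j) v \<in> nonroots V E)"

definition Chi :: "'a set \<Rightarrow> ('a \<times> 'a) set \<Rightarrow> 'a \<Rightarrow> 'a set" where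
  "Chi V E u = {v \<in> V. (u, v) \<in> E}"

definition Des :: "'a set \<Rightarrow> ('a \<times> 'a) set \<Rightarrow> 'a \<Rightarrow> 'a set" where
  "Des V E u = {v \<in> V. \<exists>n. par_pow_defined V E n v \<and> (par E ^^ n) v = u}"

definition Des_edges :: "'a set \<Rightarrow> ('a \<times> 'a) set \<Rightarrow> 'a \<Rightarrow> ('a \<times> 'a) set" where
  "Des_edges V E u = E \<inter> (Des V E u \<times> Des V E u)"

definition root_dist :: "'a set \<Rightarrow> ('a \<times> 'a) set \<Rightarrow> 'a \<Rightarrow> nat" where
  "root_dist V E v =
    (THE k. k \<ge> 1 \<and> par_pow_defined V E k v \<and> (par E ^^ k) v = tree_root V E)"

text \<open>A function on \<open>V\<close> is represented by its extension by zero to the whole type.\<close>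

definition l2 :: "'a set \<Rightarrow> ('a \<Rightarrow> complex) set" where
  "l2 V = {f. (\<forall>v. v \<notin> V \<longrightarrow> f v = 0) \<and> (\<lambda>v. (cmod (f v))\<^sup>2) summable_on V}"

definition l2_norm :: "'a set \<Rightarrow> ('a \<Rightarrow> complex) \<Rightarrow> real" where
  "l2_norm V f = sqrt (\<Sum>\<^sub>\<infinity>v\<in>V. (cmod (f v))\<^sup>2)"

definition unit_vec :: "'a \<Rightarrow> 'a \<Rightarrow> complex" where
  "unit_vec u = indicator {u}"

text \<open>An operator consists of its domain and a map, of which only the values on the domain matter.\<close>

type_synonym 'a operator = "('a \<Rightarrow> complex) set \<times> (('a \<Rightarrow> complex) \<Rightarrow> ('a \<Rightarrow> complex))"

definition bounded_operators :: "'a set \<Rightarrow> 'a operator set" where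
  "bounded_operators V = {(D, A).
     D = l2 V \<and> A ` D \<subseteq> l2 V \<and>
     (\<forall>f\<in>D. \<forall>g\<in>D. \<forall>a b. A (\<lambda>v. a * f v + b * g v) = (\<lambda>v. a * A f v + b * A g v)) \<and>
     (\<exists>C. \<forall>f\<in>D. l2_norm V (A f) \<le> C * l2_norm V f)}"

definition norm_sq_seq :: "'a set \<Rightarrow> 'a operator \<Rightarrow> ('a \<Rightarrow> complex) \<Rightarrow> nat \<Rightarrow> real" where
  "norm_sq_seq V A h n = (l2_norm V ((snd A ^^ n) h))\<^sup>2"

definition isometry :: "'a set \<Rightarrow> 'a operator \<Rightarrow> bool" where
  "isometry V A \<longleftrightarrow> A \<in> bounded_operators V \<and> (\<forall>h\<in>l2 V. l2_norm V (snd A h) = l2_norm V h)"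

definition completely_alternating :: "(nat \<Rightarrow> real) \<Rightarrow> bool" where
  "completely_alternating a \<longleftrightarrow>
    (\<forall>m n. n \<ge> 1 \<longrightarrow> (\<Sum>j=0..n. (-1) ^ j * real (n choose j) * a (m + j)) \<le> 0)"

definition represents :: "real measure \<Rightarrow> (nat \<Rightarrow> real) \<Rightarrow> bool" where
  "represents \<tau> a \<longleftrightarrow>
    sets \<tau> = sets (restrict_space borel {0..1}) \<and> finite_measure \<tau> \<and>
    (\<forall>n\<ge>1. a n = a 0 + (\<integral>s. (\<Sum>i<n. s ^ i) \<partial>\<tau>))"

text \<open>Fixing the \<open>\<sigma>\<close>-algebra in \<open>represents\<close> makes the representing measure of a completely
  alternating sequence unique as an element of the type of measures.\<close>

definition representing_measure :: "(nat \<Rightarrow> real) \<Rightarrow> real measure" where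
  "representing_measure a = (THE \<tau>. represents \<tau> a)"

definition completely_hyperexpansive :: "'a set \<Rightarrow> 'a operator \<Rightarrow> bool" where
  "completely_hyperexpansive V A \<longleftrightarrow>
    A \<in> bounded_operators V \<and> (\<forall>h\<in>l2 V. completely_alternating (norm_sq_seq V A h))"

definition shift_map ::
    "'a set \<Rightarrow> ('a \<times> 'a) set \<Rightarrow> ('a \<Rightarrow> complex) \<Rightarrow> ('a \<Rightarrow> complex) \<Rightarrow> ('a \<Rightarrow> complex)" where
  "shift_map V E lam f = (\<lambda>v. if v \<in> nonroots V E then lam v * f (par E v) else 0)"

definition weighted_shift ::
    "'a set \<Rightarrow> ('a \<times> 'a) set \<Rightarrow> ('a \<Rightarrow> complex) \<Rightarrow> 'a operator" where
  "weighted_shift V E lam = ({f \<in> l2 V. shift_map V E lam f \<in> l2 V}, shift_map V E lam)"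

definition shift_seq ::
    "'a set \<Rightarrow> ('a \<times> 'a) set \<Rightarrow> ('a \<Rightarrow> complex) \<Rightarrow> 'a \<Rightarrow> nat \<Rightarrow> real" where
  "shift_seq V E lam v = norm_sq_seq V (weighted_shift V E lam) (unit_vec v)"

definition tau :: "'a set \<Rightarrow> ('a \<times> 'a) set \<Rightarrow> ('a \<Rightarrow> complex) \<Rightarrow> 'a \<Rightarrow> real measure" where
  "tau V E lam v = representing_measure (shift_seq V E lam v)"

text \<open>Integral and sum are taken in the extended nonnegative reals: there \<open>1/0 = \<infinity>\<close>, both may be
  infinite, and a sum over infinitely many children is the unordered one.\<close>

definition moment_sum ::
    "'a set \<Rightarrow> ('a \<times> 'a) set \<Rightarrow> ('a \<Rightarrow> complex) \<Rightarrow> 'a \<Rightarrow> nat \<Rightarrow> ennreal" where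
  "moment_sum V E lam u k =
    (\<Sum>\<^sub>\<infinity>v\<in>Chi V E u.
      ennreal ((cmod (lam v))\<^sup>2) * (\<integral>\<^sup>+ s. 1 / ennreal s ^ k \<partial>tau V E lam v))"

end

(*
  A sequence a is completely alternating iff all iterated differences altdiff n a m with n >= 1 are
  <= 0.  If tau represents a, then the integral of (1-s)^i over tau is t_i = - altdiff (i+1) a 0, so
  1/s^(k+1) = sum_i binom(i+k,k) (1-s)^i turns the integrals of the theorem into the series
  inv_moment a k = sum_i binom(i+k,k) t_i; tau itself is needed only through the existence and
  uniqueness in the Hausdorff moment problem.

  Prepending c to b yields a completely alternating sequence iff b is one and
  c + inv_moment b 0 <= b 0.  The new sequence has finite inverse moments only in the case of
  equality, and these are then those of b with index shifted by one (hockey-stick identity).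
  Going up from omega one edge at a time gives all equalities and the final inequality in (ii-a).

  Since |S^n h|^2 is the sum over u of |h u|^2 |S^n e_u|^2, hyperexpansivity only has to be tested on
  the basis vectors; every vertex is an ancestor or a descendant of omega.  Without a root,
  the chain of ancestors never ends; since completely alternating sequences are concave and
  increasing, all of these sequences are then constant, and constancy passes on to descendants.
*)
theory Submission
  imports Defs "HOL-Probability.Probability" "HOL-Real_Asymp.Real_Asymp"
begin

subsection \<open>Iterated differences and backward extensions\<close>

text \<open>In terms of measures, prepending \<open>c\<close> to \<open>b\<close> turns
  \<open>d tau\<close> into \<open>d tau / s\<close> plus an atom at 0. The total mass of a
  representing measure is the first increment of its sequence, so the atom has mass
  \<open>b 0 - c - inv_moment b 0\<close>. The criterion says that this mass is not negative, and a
  positive atom makes all inverse moments infinite. Hence a sequence that is to be extended once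
  more must have no atom. This forces equality at omega and at every ancestor below the root, while
  the root may carry an atom.

  Differences are preferred to measures because omega may have infinitely many children: they are
  finite linear combinations, so they commute with unordered sums, and the criterion becomes a bound
  on partial sums, without any measure for the extended sequence. Existence and uniqueness of the
  measures remain indispensable, since \<open>representing_measure\<close> is a definite
  description.\<close>

definition altdiff :: "nat \<Rightarrow> (nat \<Rightarrow> real) \<Rightarrow> nat \<Rightarrow> real" where
  "altdiff n a m = (\<Sum>j=0..n. (-1) ^ j * real (n choose j) * a (m + j))"

lemma completely_alternating_altdiff:
  "completely_alternating a \<longleftrightarrow> (\<forall>m n. altdiff (Suc n) a m \<le> 0)"
proof -
  have "(\<forall>n\<ge>1. P n) \<longleftrightarrow> (\<forall>n. P (Suc n))" for P :: "nat \<Rightarrow> bool"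
    by (metis Suc_le_D One_nat_def le_numeral_extra(4) Suc_le_mono zero_le)
  then show ?thesis
    unfolding completely_alternating_def altdiff_def by (simp del: sum.atLeast0_atMost_Suc)
qed

lemma altdiff_0 [simp]: "altdiff 0 a m = a m"
  by (simp add: altdiff_def)

lemma altdiff_Suc: "altdiff (Suc n) a m = altdiff n a m - altdiff n a (Suc m)"
proof -
  let ?f = "\<lambda>j. (-1) ^ j * real (n choose j) * a (m + j)"
  have "altdiff (Suc n) a m = a m + (\<Sum>j\<le>n. (-1) ^ Suc j * real (Suc n choose Suc j) * a (m + Suc j))"
    unfolding altdiff_def atLeast0AtMost by (subst sum.atMost_Suc_shift) simp
  also have "\<dots> = a m + (\<Sum>j\<le>n. ?f (Suc j)) - (\<Sum>j\<le>n. (-1) ^ j * real (n choose j) * a (Suc m + j))"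
    by (simp add: sum.distrib [symmetric] sum_subtractf [symmetric] algebra_simps)
  also have "a m + (\<Sum>j\<le>n. ?f (Suc j)) = (\<Sum>j\<le>Suc n. ?f j)"
    by (subst sum.atMost_Suc_shift) simp
  also have "\<dots> = (\<Sum>j\<le>n. ?f j)" by simp
  finally show ?thesis by (simp add: altdiff_def atLeast0AtMost)
qed

lemma altdiff_1: "altdiff (Suc 0) a m = a m - a (Suc m)"
  by (simp add: altdiff_Suc)

lemma altdiff_scale: "altdiff n (\<lambda>i. c * a i) m = c * altdiff n a m"
  by (simp add: altdiff_def sum_distrib_left mult_ac)

lemma altdiff_shift: "altdiff n (\<lambda>i. a (i + k)) m = altdiff n a (m + k)"
  by (simp add: altdiff_def add_ac)

text \<open>The increments of \<open>a\<close> are the moments of a representing measure, so this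
  identity turns complete alternation into the sign condition of the Hausdorff moment
  problem.\<close>

lemma altdiff_differences: "altdiff n (\<lambda>i. a (Suc i) - a i) m = - altdiff (Suc n) a m"
  by (induction n arbitrary: m) (simp_all add: altdiff_Suc)

text \<open>Being finite linear combinations, differences pass through unordered sums. This
  transfers signs from basis vectors to all vectors and from children to their parent.\<close>

lemma altdiff_has_sum:
  fixes c :: "'i \<Rightarrow> real"
  assumes "\<And>i. ((\<lambda>x. c x * f x i) has_sum g i) A"
  shows "((\<lambda>x. c x * altdiff n (f x) m) has_sum altdiff n g m) A"
proof (induction n arbitrary: m)
  case (Suc n)
  have "((\<lambda>x. c x * altdiff n (f x) m + - (c x * altdiff n (f x) (Suc m))) has_sum
      altdiff n g m + - altdiff n g (Suc m)) A"
    by (intro has_sum_add has_sum_uminusI Suc.IH)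
  then show ?case by (simp add: altdiff_Suc algebra_simps)
qed (use assms in simp)

lemma completely_alternating_scale:
  assumes "c > 0"
  shows "completely_alternating (\<lambda>n. c * a n) \<longleftrightarrow> completely_alternating a"
  using assms by (simp add: completely_alternating_altdiff altdiff_scale mult_le_0_iff)

lemma completely_alternating_shift:
  "completely_alternating a \<Longrightarrow> completely_alternating (\<lambda>n. a (n + k))"
  by (simp add: completely_alternating_altdiff altdiff_shift)

lemma completely_alternating_incseq: "completely_alternating a \<Longrightarrow> a n \<le> a (Suc n)"
  by (metis altdiff_1 completely_alternating_altdiff diff_le_0_iff_le)

lemma completely_alternating_concave:
  assumes "completely_alternating a" and "m \<le> n"
  shows "a (Suc n) - a n \<le> a (Suc m) - a m"
proof (rule lift_Suc_antimono_le[OF _ assms(2), of "\<lambda>n. a (Suc n) - a n"])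
  fix n
  have "altdiff (Suc (Suc 0)) a n \<le> 0" using assms(1) by (auto simp: completely_alternating_altdiff)
  then show "a (Suc (Suc n)) - a (Suc n) \<le> a (Suc n) - a n" by (simp add: altdiff_Suc)
qed

section \<open>Prepending one term to a sequence\<close>

lemma altdiff_case_nat_Suc: "altdiff n (case_nat c b) (Suc m) = altdiff n b m"
  by (simp add: altdiff_def)

text \<open>Each further difference subtracts one difference of \<open>b\<close>, so everything
  telescopes. For completely alternating \<open>b\<close>, the negated value is what remains of
  \<open>b 0 - c\<close> after \<open>n\<close> terms of \<open>inv_moment b 0\<close>.\<close>

lemma altdiff_case_nat_0:
  "altdiff (Suc n) (case_nat c b) 0 = c - b 0 - (\<Sum>i<n. altdiff (Suc i) b 0)"
proof (induction n)
  case (Suc n)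
  then show ?case by (subst altdiff_Suc) (simp add: altdiff_case_nat_Suc)
qed (simp add: altdiff_Suc)

text \<open>\<open>ennreal\<close> cuts negative terms off to 0, so this is an inverse moment only
  for completely alternating \<open>a\<close>. As a series in \<open>ennreal\<close> it may be
  infinite and rearranged freely.\<close>

definition inv_moment :: "(nat \<Rightarrow> real) \<Rightarrow> nat \<Rightarrow> ennreal" where
  "inv_moment a k = (\<Sum>i. of_nat ((i + k) choose k) * ennreal (- altdiff (Suc i) a 0))"

lemma inv_moment_0: "inv_moment a 0 = (\<Sum>i. ennreal (- altdiff (Suc i) a 0))"
  by (simp add: inv_moment_def)

lemma inv_moment_scale: 
  assumes "c \<ge> 0"
  shows "inv_moment (\<lambda>n. c * a n) k = ennreal c * inv_moment a k"
proof -
  have "of_nat ((i + k) choose k) * ennreal (- altdiff (Suc i) (\<lambda>n. c * a n) 0) =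
      ennreal c * (of_nat ((i + k) choose k) * ennreal (- altdiff (Suc i) a 0))" for i
    using ennreal_mult'[OF assms, of "- altdiff (Suc i) a 0"] by (simp add: altdiff_scale ac_simps)
  then show ?thesis by (simp add: inv_moment_def)
qed

lemma suminf_ennreal_le_iff:
  assumes "\<And>i. t i \<ge> 0" and "r \<ge> 0"
  shows "(\<Sum>i. ennreal (t i)) \<le> ennreal r \<longleftrightarrow> (\<forall>n. (\<Sum>i<n. t i) \<le> r)"
  using assms by (simp add: suminf_eq_SUP SUP_le_iff sum_ennreal)

lemma suminf_ennreal_shift:
  fixes t :: "nat \<Rightarrow> ennreal"
  shows "(\<Sum>j. t (i + j)) = (\<Sum>j. if i \<le> j then t j else 0)"
proof -
  have "(\<Sum>j. if i \<le> j then t j else 0) = (\<Sum>j. if i \<le> j + i then t (j + i) else 0) + (\<Sum>j<i. if i \<le> j then t j else 0)"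
    by (rule suminf_offset) simp
  then show ?thesis by (simp add: add.commute)
qed

text \<open>The term \<open>t j\<close> lies in the tail from \<open>i\<close> iff
  \<open>i \<le> j\<close>. After interchanging the sums its coefficient is therefore a rising sum
  of binomials, which collapses to one binomial.\<close>

lemma suminf_hockey_stick:
  fixes t :: "nat \<Rightarrow> ennreal"
  shows "(\<Sum>j. of_nat ((j + Suc k) choose Suc k) * t j) = (\<Sum>i. of_nat ((i + k) choose k) * (\<Sum>j. t (i + j)))"
proof -
  let ?w = "\<lambda>i. of_nat ((i + k) choose k) :: ennreal"
  have "(\<Sum>i. ?w i * (\<Sum>j. t (i + j))) = (\<Sum>i. \<Sum>j. if i \<le> j then ?w i * t j else 0)"
    unfolding suminf_ennreal_shift ennreal_suminf_cmult[symmetric] by (intro suminf_cong) simp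
  \<comment> \<open>Reading the inner series as an integral over the counting measure makes the
    interchange an instance of termwise integration.\<close>
  also have "\<dots> = (\<Sum>i. \<integral>\<^sup>+j. (if i \<le> j then ?w i * t j else 0) \<partial>count_space UNIV)"
    by (simp add: nn_integral_count_space_nat)
  also have "\<dots> = (\<integral>\<^sup>+j. (\<Sum>i. if i \<le> j then ?w i * t j else 0) \<partial>count_space UNIV)"
    by (intro nn_integral_suminf[symmetric]) simp
  also have "\<dots> = (\<Sum>j. \<Sum>i. if i \<le> j then ?w i * t j else 0)"
    by (simp add: nn_integral_count_space_nat)
  also have "\<dots> = (\<Sum>j. of_nat ((j + Suc k) choose Suc k) * t j)"
  proof (rule suminf_cong)
    fix j
    have "(\<Sum>i. if i \<le> j then ?w i * t j else 0) = (\<Sum>i\<le>j. ?w i * t j)"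
      by (subst suminf_finite[of "{..j}"]) auto
    also have "\<dots> = of_nat (\<Sum>i\<le>j. (k + i) choose k) * t j"
      by (simp add: sum_distrib_right add.commute)
    finally show "(\<Sum>i. if i \<le> j then ?w i * t j else 0) = of_nat ((j + Suc k) choose Suc k) * t j"
      by (simp only: choose_rising_sum(1)) (simp only: ac_simps Suc_eq_plus1)
  qed
  finally show ?thesis by simp
qed

text \<open>Only the differences at index 0 are new. They are nonpositive iff all partial sums of
  the series stay below \<open>b 0 - c\<close>.\<close>

lemma completely_alternating_case_nat:
  assumes "c \<ge> 0" and "b 0 \<ge> 0"
  shows "completely_alternating (case_nat c b) \<longleftrightarrow>
    completely_alternating b \<and> ennreal c + inv_moment b 0 \<le> ennreal (b 0)"
proof -
  have "completely_alternating (case_nat c b) \<longleftrightarrow>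
      completely_alternating b \<and> (\<forall>n. altdiff (Suc n) (case_nat c b) 0 \<le> 0)"
    unfolding completely_alternating_altdiff by (metis altdiff_case_nat_Suc not0_implies_Suc)
  moreover have "(\<forall>n. altdiff (Suc n) (case_nat c b) 0 \<le> 0) \<longleftrightarrow>
      ennreal c + inv_moment b 0 \<le> ennreal (b 0)" if b: "completely_alternating b"
  proof -
    have t: "- altdiff (Suc i) b 0 \<ge> 0" for i using b by (auto simp: completely_alternating_altdiff)
    show ?thesis
    proof (cases "c \<le> b 0")
      case True
      have "ennreal c + inv_moment b 0 \<le> ennreal (b 0) \<longleftrightarrow> ennreal c + inv_moment b 0 \<le> ennreal c + ennreal (b 0 - c)"
        using True assms by (simp flip: ennreal_plus)
      also have "\<dots> \<longleftrightarrow> inv_moment b 0 \<le> ennreal (b 0 - c)"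
        by (simp add: ennreal_add_left_cancel_le)
      also have "\<dots> \<longleftrightarrow> (\<forall>n. (\<Sum>i<n. - altdiff (Suc i) b 0) \<le> b 0 - c)"
        unfolding inv_moment_0 using t True by (intro suminf_ennreal_le_iff) auto
      finally show ?thesis by (simp add: altdiff_case_nat_0 sum_negf algebra_simps)
    next
      \<comment> \<open>Here \<open>ennreal (b 0 - c)\<close> would be truncated to 0. Both sides
        fail, the left one already at the first difference.\<close>
      case False
      then have "altdiff (Suc 0) (case_nat c b) 0 > 0" by (simp add: altdiff_Suc)
      moreover have "ennreal (b 0) < ennreal c" using False assms by (simp add: ennreal_less_iff)
      then have "ennreal (b 0) < ennreal c + inv_moment b 0"
        by (meson le_iff_add order_less_le_trans)
      ultimately show ?thesis by (metis leD)
    qed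
  qed
  ultimately show ?thesis by blast
qed

text \<open>Equality leaves no remainder, so the negated differences of the extended sequence at 0
  are exactly the tails of the series for \<open>b\<close>.\<close>

lemma inv_moment_case_nat_eq:
  assumes b: "completely_alternating b" and eq: "ennreal c + inv_moment b 0 = ennreal (b 0)"
    and "c \<ge> 0" and "b 0 \<ge> 0"
  shows "inv_moment (case_nat c b) k = inv_moment b (Suc k)"
proof -
  let ?t = "\<lambda>i. - altdiff (Suc i) b 0"
  have t: "?t i \<ge> 0" for i using b by (auto simp: completely_alternating_altdiff)
  have tail: "(\<Sum>j. ennreal (?t (i + j))) = ennreal (- altdiff (Suc i) (case_nat c b) 0)" for i
  proof -
    have p: "sum ?t {..<i} \<ge> 0" using t by (intro sum_nonneg) auto
    have "(\<Sum>j. ennreal (?t j)) = (\<Sum>j. ennreal (?t (j + i))) + (\<Sum>j<i. ennreal (?t j))"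
      by (rule suminf_offset) simp
    also have "(\<Sum>j<i. ennreal (?t j)) = ennreal (sum ?t {..<i})" using t by (intro sum_ennreal) auto
    finally have "ennreal (b 0) = ennreal (c + sum ?t {..<i}) + (\<Sum>j. ennreal (?t (i + j)))"
      using eq assms(3) p by (simp add: inv_moment_0 add_ac)
    then have "(\<Sum>j. ennreal (?t (i + j))) = ennreal (b 0) - ennreal (c + sum ?t {..<i})"
      by (simp add: ennreal_add_diff_cancel_left)
    also have "\<dots> = ennreal (b 0 - (c + sum ?t {..<i}))"
      using assms p by (intro ennreal_minus) auto
    also have "b 0 - (c + sum ?t {..<i}) = - altdiff (Suc i) (case_nat c b) 0"
      by (simp add: altdiff_case_nat_0 sum_negf)
    finally show ?thesis .
  qed
  show ?thesis unfolding inv_moment_def suminf_hockey_stick tail ..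
qed

text \<open>The gap in the inequality, which is the mass of the atom at 0, bounds every negated
  difference at 0 from below. The binomial weights are at least 1, so the series diverges.\<close>

lemma inv_moment_case_nat_top:
  assumes b: "completely_alternating b" and less: "ennreal c + inv_moment b 0 < ennreal (b 0)"
    and "c \<ge> 0" and "b 0 \<ge> 0"
  shows "inv_moment (case_nat c b) k = top"
proof -
  let ?t = "\<lambda>i. - altdiff (Suc i) b 0"
  have t: "?t i \<ge> 0" for i using b by (auto simp: completely_alternating_altdiff)
  obtain r where r: "r \<ge> 0" "inv_moment b 0 = ennreal r"
    using less by (cases "inv_moment b 0") auto
  have "c + r < b 0" using less r assms(3) by (simp add: ennreal_less_iff flip: ennreal_plus)
  have "(\<Sum>i<n. ?t i) \<le> r" for n
    using suminf_ennreal_le_iff[THEN iffD1, OF t r(1)] r(2) unfolding inv_moment_0 by simp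
  then have le: "b 0 - c - r \<le> - altdiff (Suc i) (case_nat c b) 0" for i
    unfolding altdiff_case_nat_0 by (simp add: sum_negf) (smt (verit))
  have "(\<Sum>i::nat. ennreal (b 0 - c - r)) \<le> inv_moment (case_nat c b) k"
    unfolding inv_moment_def
  proof (intro suminf_le summableI)
    fix i
    have "ennreal (b 0 - c - r) \<le> 1 * ennreal (- altdiff (Suc i) (case_nat c b) 0)"
      using le by (simp add: ennreal_leI)
    also have "\<dots> \<le> of_nat ((i + k) choose k) * ennreal (- altdiff (Suc i) (case_nat c b) 0)"
    proof (intro mult_right_mono)
      have "1 \<le> (i + k) choose k" by (simp add: Suc_le_eq)
      then show "(1 :: ennreal) \<le> of_nat ((i + k) choose k)" by (metis of_nat_1 of_nat_le_iff)
    qed simp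
    finally show "ennreal (b 0 - c - r) \<le> of_nat ((i + k) choose k) * ennreal (- altdiff (Suc i) (case_nat c b) 0)" .
  qed
  moreover have "(\<Sum>i::nat. ennreal (b 0 - c - r)) = top"
    using \<open>c + r < b 0\<close> nn_integral_count_space_nat[of "\<lambda>_. ennreal (b 0 - c - r)"]
    by (simp add: ennreal_mult_top)
  ultimately show ?thesis by (simp add: top_unique)
qed

text \<open>Model of the path from omega up to the root: \<open>x k\<close> stands for the sequence
  at the \<open>k\<close>-th ancestor, \<open>l k\<close> for the squared modulus of the weight on
  the edge from the \<open>k\<close>-th ancestor down to the previous one.\<close>

locale backward_extensions =
  fixes b :: "nat \<Rightarrow> real" and x :: "nat \<Rightarrow> nat \<Rightarrow> real" and l :: "nat \<Rightarrow> real"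
  assumes x_0: "x 0 = case_nat 1 b" and b_nonneg: "b 0 \<ge> 0"
    and x_Suc: "\<And>k. x (Suc k) = case_nat 1 (\<lambda>n. l (Suc k) * x k n)"
    and l_pos: "\<And>k. l k > 0"
begin

lemma x_at_0 [simp]: "x k 0 = 1"
  by (cases k) (simp_all add: x_0 x_Suc)

text \<open>Equality in the step from \<open>b\<close> to \<open>x 0\<close> and in the steps to
  \<open>x 1\<close>, ..., \<open>x k\<close>, with the moments of the earlier sequences already
  expressed through \<open>b\<close>.\<close>

definition "balanced k \<longleftrightarrow> 1 + inv_moment b 0 = ennreal (b 0) \<and>
  (\<forall>i. 1 \<le> i \<and> i \<le> k \<longrightarrow> ennreal (l i) = 1 + ennreal (\<Prod>j=1..i. l j) * inv_moment b i)"

lemma balanced_Suc: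
  "balanced (Suc k) \<longleftrightarrow>
    balanced k \<and> ennreal (l (Suc k)) = 1 + ennreal (\<Prod>j=1..Suc k. l j) * inv_moment b (Suc k)"
  unfolding balanced_def by (auto simp: le_Suc_eq)

lemma completely_alternating_x_Suc:
  "completely_alternating (x (Suc k)) \<longleftrightarrow>
    completely_alternating (x k) \<and> 1 + ennreal (l (Suc k)) * inv_moment (x k) 0 \<le> ennreal (l (Suc k))"
  using l_pos[of "Suc k"]
  by (simp add: x_Suc completely_alternating_case_nat completely_alternating_scale inv_moment_scale)

text \<open>A balanced step contributes one factor \<open>l\<close> and raises the moment index by
  one. \<open>Suc k\<close> counts \<open>k\<close> such steps and the initial one from
  \<open>b\<close> to \<open>x 0\<close>.\<close>

lemma inv_moment_x:
  assumes "completely_alternating (x 0)" "balanced k"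
  shows "completely_alternating (x k) \<and>
    (\<forall>m. inv_moment (x k) m = ennreal (\<Prod>j=1..k. l j) * inv_moment b (Suc k + m))"
  using assms(2)
proof (induction k)
  case 0
  have "completely_alternating b"
    using assms(1) b_nonneg by (simp add: x_0 completely_alternating_case_nat)
  then show ?case
    using assms(1) b_nonneg 0 by (simp add: x_0 inv_moment_case_nat_eq balanced_def)
next
  case (Suc k)
  let ?L = "\<lambda>k. \<Prod>j=1..k. l j"
  have L: "ennreal (l (Suc k)) * (ennreal (?L k) * y) = ennreal (?L (Suc k)) * y" for y
  proof -
    have "?L k \<ge> 0" using l_pos by (intro prod_nonneg) (simp add: less_imp_le)
    then show ?thesis
      using l_pos[of "Suc k"] by (simp add: ennreal_mult' mult_ac)
  qed
  have IH: "completely_alternating (x k)" "\<And>m. inv_moment (x k) m = ennreal (?L k) * inv_moment b (Suc k + m)"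
    using Suc by (auto simp: balanced_Suc)
  have eq: "1 + ennreal (l (Suc k)) * inv_moment (x k) 0 = ennreal (l (Suc k))"
    using Suc.prems unfolding balanced_Suc IH L by simp
  have "inv_moment (x (Suc k)) m = ennreal (l (Suc k)) * inv_moment (x k) (Suc m)" for m
    using eq l_pos[of "Suc k"] IH(1) unfolding x_Suc
    by (subst inv_moment_case_nat_eq)
       (simp_all add: completely_alternating_scale inv_moment_scale less_imp_le)
  then show ?case
    using IH eq unfolding completely_alternating_x_Suc by (simp only: L) simp
qed

text \<open>Extending \<open>x k\<close> needs \<open>inv_moment (x k) 0\<close> to be finite, which
  excludes a strict inequality in the step that produced \<open>x k\<close>.\<close>

lemma balanced_if_completely_alternating:
  assumes "completely_alternating (x (Suc k))"
  shows "completely_alternating (x 0) \<and> balanced k"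
  using assms
proof (induction k)
  case 0
  then have x0: "completely_alternating (x 0)" and "inv_moment (x 0) 0 \<noteq> top"
    using l_pos[of 1] by (auto simp: completely_alternating_x_Suc ennreal_mult_top top_unique)
  moreover have b: "completely_alternating b" "1 + inv_moment b 0 \<le> ennreal (b 0)"
    using x0 b_nonneg by (simp_all add: x_0 completely_alternating_case_nat)
  ultimately have "1 + inv_moment b 0 = ennreal (b 0)"
    using inv_moment_case_nat_top[of b 1 0] b_nonneg by (force simp: x_0)
  then show ?case using x0 by (simp add: balanced_def)
next
  case (Suc k)
  from Suc.prems have xk: "completely_alternating (x (Suc k))" and "inv_moment (x (Suc k)) 0 \<noteq> top"
    using l_pos[of "Suc (Suc k)"]
    by (auto simp: completely_alternating_x_Suc[of "Suc k"] ennreal_mult_top top_unique)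
  moreover have "completely_alternating (x k)"
      and le: "1 + ennreal (l (Suc k)) * inv_moment (x k) 0 \<le> ennreal (l (Suc k))"
    using xk by (simp_all add: completely_alternating_x_Suc)
  ultimately have eq: "1 + ennreal (l (Suc k)) * inv_moment (x k) 0 = ennreal (l (Suc k))"
    using inv_moment_case_nat_top[of "\<lambda>n. l (Suc k) * x k n" 1 0] l_pos[of "Suc k"]
    by (force simp: x_Suc completely_alternating_scale inv_moment_scale less_imp_le)
  have IH: "completely_alternating (x 0)" "balanced k" using Suc.IH xk by auto
  have "(\<Prod>j=1..k. l j) \<ge> 0" using l_pos by (intro prod_nonneg) (simp add: less_imp_le)
  then have "ennreal (l (Suc k)) = 1 + ennreal (\<Prod>j=1..Suc k. l j) * inv_moment b (Suc k)"
    using eq inv_moment_x[OF IH] l_pos[of "Suc k"] by (simp add: ennreal_mult' mult_ac)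
  then show ?case using IH unfolding balanced_Suc by simp
qed

text \<open>Nothing is prepended to \<open>x (Suc k)\<close> here, so the last step may be
  strict.\<close>

lemma completely_alternating_x_iff:
  "completely_alternating (x (Suc k)) \<longleftrightarrow> completely_alternating (x 0) \<and> balanced k \<and>
     1 + ennreal (\<Prod>j=1..Suc k. l j) * inv_moment b (Suc k) \<le> ennreal (l (Suc k))"
proof -
  have "(\<Prod>j=1..k. l j) \<ge> 0" using l_pos by (intro prod_nonneg) (simp add: less_imp_le)
  then have "ennreal (l (Suc k)) * inv_moment (x k) 0 = ennreal (\<Prod>j=1..Suc k. l j) * inv_moment b (Suc k)"
    if "completely_alternating (x 0)" "balanced k"
    using inv_moment_x[OF that] l_pos[of "Suc k"] by (simp add: ennreal_mult' mult_ac)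
  then show ?thesis
    using balanced_if_completely_alternating inv_moment_x completely_alternating_x_Suc by metis
qed

end

text \<open>The first increment of \<open>x 0\<close> reappears, scaled by \<open>L k\<close>, as
  the increment of \<open>x k\<close> at index \<open>k\<close>. Concavity makes all
  \<open>k\<close> earlier increments at least as large, although their sum is only
  \<open>L k - 1\<close>. For large \<open>k\<close> this is impossible if the increment is
  positive.\<close>

lemma infinite_backward_extensions_const:
  assumes x_Suc: "\<And>k. x (Suc k) = case_nat 1 (\<lambda>n. l (Suc k) * x k n)"
    and l_pos: "\<And>k. l k > (0 :: real)" and x_0: "x 0 0 = 1"
    and ca: "\<And>k. completely_alternating (x k)"
  shows "x 0 n = 1"
proof -
  define L where "L k = (\<Prod>j=1..k. l j)" for k
  have L_pos: "L k > 0" for k unfolding L_def using l_pos by (intro prod_pos) simp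
  have x_plus: "x k (k + n) = L k * x 0 n" for k n
    by (induction k arbitrary: n) (simp_all add: x_Suc L_def mult_ac)
  have x_at_0: "x k 0 = 1" for k using x_0 by (cases k) (simp_all add: x_Suc)
  have bound: "real k * (x 0 1 - 1) \<le> 1" for k
  proof -
    have "real k * (L k * (x 0 1 - 1)) = (\<Sum>i<k. x k (Suc k) - x k k)"
      using x_plus[of k 1] x_plus[of k 0] x_0 by (simp add: algebra_simps)
    also have "\<dots> \<le> (\<Sum>i<k. x k (Suc i) - x k i)"
      by (intro sum_mono completely_alternating_concave ca) simp
    also have "\<dots> = L k - 1"
      using x_plus[of k 0] x_0 by (simp add: sum_lessThan_telescope x_at_0)
    also have "\<dots> \<le> L k * 1" by simp
    finally have "L k * (real k * (x 0 1 - 1)) \<le> L k * 1" by (simp add: mult_ac)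
    then show ?thesis using L_pos[of k] by (simp only: mult_le_cancel_left_pos)
  qed
  have "x 0 1 \<le> 1"
  proof (rule ccontr)
    assume "\<not> x 0 1 \<le> 1"
    then obtain k where "1 < real k * (x 0 1 - 1)" using reals_Archimedean3[of "x 0 1 - 1"] by auto
    with bound[of k] show False by simp
  qed
  show ?thesis
  proof (induction n)
    case (Suc n)
    have "x 0 (Suc n) - x 0 n \<le> x 0 (Suc 0) - x 0 0" by (intro completely_alternating_concave ca) simp
    then show ?case
      using Suc x_0 \<open>x 0 1 \<le> 1\<close> completely_alternating_incseq[OF ca, of 0 n] by simp
  qed (rule x_0)
qed

subsection \<open>The Hausdorff moment problem\<close>

text \<open>With the shift operator \<open>T\<close> this is the binomial expansion of
  \<open>(T + (1 - T)) ^ n\<close>, since \<open>altdiff (n - k)\<close> is a power of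
  \<open>1 - T\<close>.\<close>

lemma sum_choose_altdiff:
  "(\<Sum>k\<le>n. real (n choose k) * altdiff (n - k) c (k + m)) = c m"
proof (induction n arbitrary: m)
  case (Suc n)
  let ?d = "\<lambda>k. altdiff (n - k) c"
  have "(\<Sum>k\<le>Suc n. real (Suc n choose k) * altdiff (Suc n - k) c (k + m)) =
      altdiff (Suc n) c m + (\<Sum>k\<le>n. real (n choose Suc k) * ?d k (Suc k + m))
      + (\<Sum>k\<le>n. real (n choose k) * ?d k (Suc k + m))"
    by (subst sum.atMost_Suc_shift) (simp add: sum.distrib algebra_simps)
  also have "altdiff (Suc n) c m + (\<Sum>k\<le>n. real (n choose Suc k) * ?d k (Suc k + m)) =
      (\<Sum>k\<le>Suc n. real (n choose k) * altdiff (Suc n - k) c (k + m))"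
    by (subst sum.atMost_Suc_shift) simp
  also have "\<dots> = (\<Sum>k\<le>n. real (n choose k) * altdiff (Suc n - k) c (k + m))"
    by simp
  also have "\<dots> = (\<Sum>k\<le>n. real (n choose k) * (?d k (k + m) - ?d k (Suc k + m)))"
    by (intro sum.cong) (simp_all add: Suc_diff_le altdiff_Suc)
  finally show ?case using Suc.IH[of m] by (simp add: algebra_simps sum.distrib sum_subtractf)
qed simp

text \<open>Factorial moments of the approximating point masses. The factor
  \<open>k choose m\<close> merges with \<open>n choose k\<close> and reduces the sum to the
  previous expansion with \<open>n - m\<close> in place of \<open>n\<close>.\<close>

lemma sum_choose_altdiff_moment:
  assumes "m \<le> n"
  shows "(\<Sum>k\<le>n. real (n choose k) * altdiff (n - k) c k * (real (k choose m) / real (n choose m))) = c m"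
proof -
  let ?f = "\<lambda>k. real (n choose k) * altdiff (n - k) c k * (real (k choose m) / real (n choose m))"
  have "(\<Sum>k\<le>n. ?f k) = (\<Sum>k=m..n. ?f k)"
    by (intro sum.mono_neutral_right) auto
  also have "\<dots> = (\<Sum>k\<le>n - m. ?f (k + m))"
    using assms by (intro sum.reindex_bij_witness[of _ "\<lambda>k. k + m" "\<lambda>k. k - m"]) auto
  also have "\<dots> = (\<Sum>k\<le>n - m. real ((n - m) choose k) * altdiff (n - m - k) c (k + m))"
  proof (intro sum.cong refl)
    fix k assume "k \<in> {..n - m}"
    then have "real (n choose (k + m)) * real ((k + m) choose m) = real (n choose m) * real ((n - m) choose k)"
      using choose_mult[of m "k + m" n] assms by (simp flip: of_nat_mult)
    moreover have "real (n choose m) > 0" using assms by simp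
    ultimately show "?f (k + m) = real ((n - m) choose k) * altdiff (n - m - k) c (k + m)"
      by (simp add: field_simps)
  qed
  also have "\<dots> = c m" by (rule sum_choose_altdiff)
  finally show ?thesis .
qed

text \<open>Passes from factorial to ordinary moments: the quotient is a product of \<open>m\<close>
  factors close to \<open>k / n\<close>, with an error that vanishes uniformly in \<open>k\<close>
  as \<open>n\<close> grows.\<close>

lemma choose_quotient_power_diff:
  assumes "k \<le> n" "2 * m < n"
  shows "\<bar>real (k choose m) / real (n choose m) - (real k / real n) ^ m\<bar> \<le> real m * (real m / (real n - real m))"
proof -
  let ?q = "\<lambda>i. (real k - real i) / (real n - real i)"
  have "real (k choose m) / real (n choose m) = (\<Prod>i<m. ?q i)"
    unfolding binomial_gbinomial gbinomial_altdef_of_nat atLeast0LessThan prod_dividef[symmetric]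
    by (intro prod.cong) auto
  \<comment> \<open>Factors with \<open>k < i\<close> are negative; \<open>2 * m < n\<close> keeps
    their modulus at most 1, as the product estimate requires.\<close>
  moreover have "\<bar>(\<Prod>i<m. ?q i) - (\<Prod>i<m. real k / real n)\<bar> \<le> (\<Sum>i<m. \<bar>?q i - real k / real n\<bar>)"
    using assms by (intro norm_prod_diff[where 'a=real, unfolded real_norm_def])
      (auto simp: divide_le_eq abs_le_iff field_simps)
  moreover have "(\<Sum>i<m. \<bar>?q i - real k / real n\<bar>) \<le> (\<Sum>i<m. real m / (real n - real m))"
  proof (intro sum_mono)
    fix i assume i: "i \<in> {..<m}"
    have "?q i - real k / real n = - (real i / (real n - real i)) * (1 - real k / real n)"
      using i assms by (simp add: field_simps)
    also have "\<bar>\<dots>\<bar> = (real i / (real n - real i)) * (1 - real k / real n)"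
      using i assms by (simp add: abs_mult)
    also have "\<dots> \<le> (real i / (real n - real i)) * 1"
      using i assms by (intro mult_left_mono) auto
    also have "\<dots> \<le> real m / (real n - real m)"
      using i assms by (simp, intro frac_le) auto
    finally show "\<bar>?q i - real k / real n\<bar> \<le> real m / (real n - real m)" .
  qed
  ultimately show ?thesis by simp
qed

lemma hausdorff_moment_normalized:
  assumes pos: "\<And>n m. altdiff n c m \<ge> 0" and "c 0 = 1"
  obtains M where "real_distribution M" "\<And>m. (\<integral>x. (max 0 (min 1 x)) ^ m \<partial>M) = c m"
proof -
  \<comment> \<open>The solution is a weak limit of the measures with mass \<open>p N k\<close> at \<open>k / N\<close>, whose \<open>m\<close>-th
    normalized factorial moments are exactly \<open>c m\<close>; clamping to the unit interval makes the integrands bounded.\<close>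
  define p where "p N k = (if k \<le> N then real (N choose k) * altdiff (N - k) c k else 0)" for N k
  have p_nonneg: "p N k \<ge> 0" for N k using pos by (simp add: p_def)
  have p_sum: "(\<Sum>k\<le>N. p N k) = 1" for N
    using sum_choose_altdiff[of N c 0] \<open>c 0 = 1\<close> by (simp add: p_def)
  have p_nn: "(\<integral>\<^sup>+k. ennreal (p N k) \<partial>count_space UNIV) = 1" for N
  proof -
    have "(\<integral>\<^sup>+k. ennreal (p N k) \<partial>count_space UNIV) = (\<Sum>k\<le>N. ennreal (p N k))"
      by (subst nn_integral_count_space'[of "{..N}"]) (auto simp: p_def)
    also have "\<dots> = 1" using p_sum p_nonneg by (simp add: sum_ennreal)
    finally show ?thesis .
  qed
  define q where "q N = embed_pmf (p N)" for N
  have pmf_q: "pmf (q N) k = p N k" for N k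
    unfolding q_def using p_nonneg p_nn by (intro pmf_embed_pmf)
  have set_q: "set_pmf (q N) \<subseteq> {..N}" for N by (auto simp: set_pmf_eq pmf_q p_def)
  define \<mu> where "\<mu> N = distr (measure_pmf (q (Suc N))) borel (\<lambda>k. real k / real (Suc N))" for N
  have distribution: "real_distribution (\<mu> N)" for N
    unfolding \<mu>_def by (intro prob_space.real_distribution_distr measure_pmf.prob_space_axioms) auto
  have integral_\<mu>: "(\<integral>x. f x \<partial>\<mu> N) = (\<Sum>k\<le>Suc N. f (real k / real (Suc N)) * p (Suc N) k)"
    if "f \<in> borel_measurable borel" for f :: "real \<Rightarrow> real" and N
  proof -
    have "(\<integral>x. f x \<partial>\<mu> N) = (\<integral>k. f (real k / real (Suc N)) \<partial>measure_pmf (q (Suc N)))"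
      unfolding \<mu>_def using that by (intro integral_distr) auto
    also have "\<dots> = (\<Sum>k\<le>Suc N. f (real k / real (Suc N)) * pmf (q (Suc N)) k)"
      using set_q[of "Suc N"] by (intro integral_measure_pmf_real) auto
    finally show ?thesis unfolding pmf_q .
  qed
  have "tight \<mu>"
    unfolding tight_def
  proof (intro conjI allI impI distribution)
    fix \<epsilon> :: real assume "\<epsilon> > 0"
    \<comment> \<open>The left end -1 lets the half-open interval contain the mass point 0.\<close>
    have "measure (\<mu> N) {-1<..1} = 1" for N
    proof -
      have "measure (\<mu> N) {-1<..1} = measure (measure_pmf (q (Suc N))) ((\<lambda>k. real k / real (Suc N)) -` {-1<..1})"
        unfolding \<mu>_def by (subst measure_distr) auto
      also have "\<dots> = 1"
        using set_q[of "Suc N"]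
        by (subst measure_pmf.prob_eq_1) (force simp: AE_measure_pmf_iff field_simps)+
      finally show ?thesis .
    qed
    then show "\<exists>a b. a < b \<and> (\<forall>n. 1 - \<epsilon> < measure (\<mu> n) {a<..b})"
      using \<open>\<epsilon> > 0\<close> by (intro exI[of _ "-1"] exI[of _ 1]) auto
  qed
  then obtain r M where r: "strict_mono r" "real_distribution M" "weak_conv_m (\<mu> \<circ> id \<circ> r) M"
    using tight_imp_convergent_subsubsequence[of \<mu> id] by (auto simp: strict_mono_def)
  have "(\<integral>x. (max 0 (min 1 x)) ^ m \<partial>M) = c m" for m
  proof -
    let ?f = "\<lambda>x :: real. (max 0 (min 1 x)) ^ m"
    have lim1: "(\<lambda>N. \<integral>x. ?f x \<partial>(\<mu> \<circ> id \<circ> r) N) \<longlonglongrightarrow> (\<integral>x. ?f x \<partial>M)"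
      using r(2,3) distribution
      by (intro weak_conv_imp_integral_bdd_continuous_conv[where B=1] continuous_intros)
        (auto intro!: continuous_intros power_le_one simp: o_def)
    have "(\<lambda>N. \<integral>x. ?f x \<partial>\<mu> N) \<longlonglongrightarrow> c m"
    proof (rule LIM_zero_cancel, rule Lim_null_comparison)
      show "(\<lambda>N. real m * (real m / (real (Suc N) - real m))) \<longlonglongrightarrow> 0"
        by real_asymp
      show "\<forall>\<^sub>F N in sequentially. norm ((\<integral>x. ?f x \<partial>\<mu> N) - c m) \<le> real m * (real m / (real (Suc N) - real m))"
        using eventually_ge_at_top[of "2 * m"]
      proof eventually_elim
        case (elim N)
        let ?n = "Suc N"
        let ?e = "real m * (real m / (real ?n - real m))"
        have "(\<Sum>k\<le>?n. p ?n k * (real (k choose m) / real (?n choose m))) = c m"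
          using sum_choose_altdiff_moment[of m ?n c] elim by (simp add: p_def del: sum.atMost_Suc)
        moreover have "(\<integral>x. ?f x \<partial>\<mu> N) = (\<Sum>k\<le>?n. ?f (real k / real ?n) * p ?n k)"
          by (rule integral_\<mu>) measurable
        moreover have "\<dots> = (\<Sum>k\<le>?n. p ?n k * (real k / real ?n) ^ m)"
        proof (intro sum.cong refl)
          fix k assume "k \<in> {..?n}"
          then have "max 0 (min 1 (real k / real ?n)) = real k / real ?n" by (auto simp: min_def)
          then show "?f (real k / real ?n) * p ?n k = p ?n k * (real k / real ?n) ^ m" by simp
        qed
        ultimately have "\<bar>(\<integral>x. ?f x \<partial>\<mu> N) - c m\<bar> =
            \<bar>\<Sum>k\<le>?n. p ?n k * (real (k choose m) / real (?n choose m) - (real k / real ?n) ^ m)\<bar>"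
          by (simp add: right_diff_distrib sum_subtractf abs_minus_commute del: sum.atMost_Suc)
        also have "\<dots> \<le> (\<Sum>k\<le>?n. p ?n k * ?e)"
        proof (intro order.trans[OF sum_abs] sum_mono)
          fix k assume "k \<in> {..?n}"
          then have "\<bar>real (k choose m) / real (?n choose m) - (real k / real ?n) ^ m\<bar> \<le> ?e"
            using elim by (intro choose_quotient_power_diff) auto
          then show "\<bar>p ?n k * (real (k choose m) / real (?n choose m) - (real k / real ?n) ^ m)\<bar> \<le> p ?n k * ?e"
            unfolding abs_mult abs_of_nonneg[OF p_nonneg] by (rule mult_left_mono) (rule p_nonneg)
        qed
        also have "\<dots> = ?e"
          by (simp only: p_sum sum_distrib_right[symmetric] mult_1_left)
        finally show ?case by simp
      qed
    qed
    then have "(\<lambda>N. \<integral>x. ?f x \<partial>(\<mu> \<circ> id \<circ> r) N) \<longlonglongrightarrow> c m"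
      using LIMSEQ_subseq_LIMSEQ[OF _ r(1)] by (force simp: o_def)
    with lim1 show ?thesis by (rule LIMSEQ_unique)
  qed
  with r(2) show ?thesis by (rule that)
qed

lemma integrable_unit_interval:
  fixes f :: "real \<Rightarrow> real" and M :: "real measure"
  assumes "finite_measure M" "sets M = sets (restrict_space borel {0..1})" "continuous_on {0..1} f"
  shows "integrable M f"
proof -
  interpret finite_measure M by fact
  have sp: "space M = {0..1}" using sets_eq_imp_space_eq[OF assms(2)] by (simp add: space_restrict_space)
  have "compact (f ` {0..1})" using assms(3) by (intro compact_continuous_image) auto
  then obtain B where B: "\<And>x. x \<in> {0..1} \<Longrightarrow> norm (f x) \<le> B"
    by (metis bounded_iff compact_imp_bounded image_eqI)
  have "f \<in> borel_measurable M"
    unfolding measurable_cong_sets[OF assms(2) refl]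
    by (rule borel_measurable_continuous_on_restrict[OF assms(3)])
  then show ?thesis using B sp by (intro integrable_const_bound[of _ B]) auto
qed

lemma hausdorff_moment:
  assumes pos: "\<And>n m. altdiff n c m \<ge> 0"
  obtains \<tau> where "finite_measure \<tau>" "sets \<tau> = sets (restrict_space borel {0..1::real})"
    "\<And>m. (\<integral>s. s ^ m \<partial>\<tau>) = c m"
proof (cases "c 0 = 0")
  case True
  \<comment> \<open>The sequence is nonnegative and decreasing.\<close>
  have "c m = 0" for m
  proof (induction m)
    case (Suc m)
    then show ?case using pos[of 0 "Suc m"] pos[of 1 m] by (simp add: altdiff_Suc)
  qed (rule True)
  moreover have "(\<integral>s. f s \<partial>null_measure (restrict_space borel {0..1::real})) = 0" for f :: "real \<Rightarrow> real"
    by (rule integral_null_measure)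
  ultimately show ?thesis
    by (intro that[of "null_measure (restrict_space borel {0..1})"] finite_measureI) simp_all
next
  case False
  then have c0: "c 0 > 0" using pos[of 0 0] by simp
  define c' where "c' n = inverse (c 0) * c n" for n
  have "altdiff n c' m \<ge> 0" for n m
    unfolding c'_def altdiff_scale using pos c0 by simp
  then obtain M where M: "real_distribution M" "\<And>m. (\<integral>x. (max 0 (min 1 x)) ^ m \<partial>M) = c' m"
    using hausdorff_moment_normalized[of c'] c0 by (auto simp: c'_def)
  interpret M: real_distribution M by fact
  let ?I = "restrict_space borel {0..1::real}"
  let ?f = "\<lambda>x :: real. max 0 (min 1 x)"
  \<comment> \<open>\<open>M\<close> lives on the whole line. Its image under clamping lives on the
    unit interval with the sigma-algebra that \<open>represents\<close> demands, and its moments are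
    the clamped moments of \<open>M\<close>.\<close>
  define \<nu> where "\<nu> = distr M ?I ?f"
  have f: "?f \<in> measurable M ?I"
    by (intro measurable_restrict_space2) (auto simp: M.space_eq_univ)
  define \<tau> where "\<tau> = density \<nu> (\<lambda>_. ennreal (c 0))"
  interpret \<nu>: prob_space \<nu> unfolding \<nu>_def by (rule M.prob_space_distr[OF f])
  have "sets \<tau> = sets ?I" by (simp add: \<tau>_def \<nu>_def)
  moreover have "finite_measure \<tau>"
    by (intro finite_measureI) (simp add: \<tau>_def emeasure_density ennreal_mult_eq_top_iff \<nu>.emeasure_space_1)
  moreover have "(\<integral>s. s ^ m \<partial>\<tau>) = c m" for m
  proof -
    have meas: "(\<lambda>s. s ^ m) \<in> borel_measurable ?I"
      by (intro borel_measurable_continuous_on_restrict continuous_intros)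
    have "(\<integral>s. s ^ m \<partial>\<tau>) = (\<integral>s. c 0 *\<^sub>R s ^ m \<partial>\<nu>)"
      unfolding \<tau>_def using c0 meas by (intro integral_density) (auto simp: \<nu>_def)
    also have "\<dots> = c 0 * (\<integral>s. s ^ m \<partial>\<nu>)" by simp
    also have "(\<integral>s. s ^ m \<partial>\<nu>) = c' m"
      unfolding \<nu>_def using f meas M(2) by (subst integral_distr) auto
    finally show ?thesis using c0 by (simp add: c'_def)
  qed
  ultimately show ?thesis by (intro that)
qed

text \<open>Equal moments give equal integrals of polynomials, and these approximate
  \<open>f\<close> uniformly on the unit interval.\<close>

lemma moments_determine_integral:
  fixes f :: "real \<Rightarrow> real"
  assumes M: "finite_measure M" "sets M = sets (restrict_space borel {0..1})"
    and N: "finite_measure N" "sets N = sets (restrict_space borel {0..1})"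
    and moments: "\<And>m. (\<integral>s. s ^ m \<partial>M) = (\<integral>s. s ^ m \<partial>N)"
    and f: "continuous_on {0..1} f"
  shows "(\<integral>s. f s \<partial>M) = (\<integral>s. f s \<partial>N)"
proof -
  interpret M: finite_measure M by fact
  interpret N: finite_measure N by fact
  \<comment> \<open>The two approximation errors add up to at most \<open>e / K\<close> times both
    total masses; the summand 1 keeps \<open>K\<close> positive.\<close>
  define K where "K = measure M (space M) + measure N (space N) + 1"
  have K: "K > 0" by (simp add: K_def add_nonneg_pos)
  have approx: "\<bar>(\<integral>s. f s \<partial>L) - (\<integral>s. g s \<partial>L)\<bar> \<le> e * measure L (space L)"
    if L: "finite_measure L" "sets L = sets (restrict_space borel {0..1})"
      and g: "continuous_on {0..1} g" and close: "\<And>x. x \<in> {0..1} \<Longrightarrow> \<bar>f x - g x\<bar> < e"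
    for L and g :: "real \<Rightarrow> real" and e
  proof -
    interpret L: finite_measure L by fact
    have sp: "space L = {0..1}" using sets_eq_imp_space_eq[OF L(2)] by (simp add: space_restrict_space)
    have "(\<integral>s. f s \<partial>L) - (\<integral>s. g s \<partial>L) = (\<integral>s. f s - g s \<partial>L)"
      using integrable_unit_interval[OF L] f g by simp
    also have "norm \<dots> \<le> (\<integral>s. norm (f s - g s) \<partial>L)" by (rule integral_norm_bound)
    also have "\<dots> \<le> (\<integral>s. e \<partial>L)"
      using close sp f g
      by (intro integral_mono integrable_unit_interval[OF L] continuous_intros) (auto intro: less_imp_le)
    finally show ?thesis by (simp add: mult.commute)
  qed
  have "\<bar>(\<integral>s. f s \<partial>M) - (\<integral>s. f s \<partial>N)\<bar> \<le> 0 + e" if "e > 0" for e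
  proof -
    obtain g where g: "real_polynomial_function g" "\<And>x. x \<in> {0..1} \<Longrightarrow> \<bar>f x - g x\<bar> < e / K"
      using Stone_Weierstrass_real_polynomial_function[OF compact_Icc f, of "e / K"] \<open>e > 0\<close> K by auto
    obtain a n where a: "g = (\<lambda>x. \<Sum>i\<le>n. a i * x ^ i)"
      using g(1) unfolding real_polynomial_function_iff_sum by auto
    have cont: "continuous_on {0..1} g" unfolding a by (intro continuous_intros)
    have poly: "(\<integral>s. g s \<partial>L) = (\<Sum>i\<le>n. a i * (\<integral>s. s ^ i \<partial>L))"
      if L: "finite_measure L" "sets L = sets (restrict_space borel {0..1})" for L
    proof -
      have "(\<integral>s. g s \<partial>L) = (\<Sum>i\<le>n. \<integral>s. a i * s ^ i \<partial>L)"
        unfolding a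
        by (intro Bochner_Integration.integral_sum integrable_unit_interval[OF L] continuous_intros)
      then show ?thesis by simp
    qed
    have "(\<integral>s. g s \<partial>M) = (\<integral>s. g s \<partial>N)" by (simp add: poly M N moments)
    with approx[OF M cont g(2)] approx[OF N cont g(2)]
    have "\<bar>(\<integral>s. f s \<partial>M) - (\<integral>s. f s \<partial>N)\<bar> \<le> e / K * measure M (space M) + e / K * measure N (space N)"
      by linarith
    also have "\<dots> \<le> e / K * K"
      using \<open>e > 0\<close> K unfolding distrib_left[symmetric] by (intro mult_left_mono) (auto simp: K_def)
    finally show ?thesis using K by simp
  qed
  then show ?thesis using field_le_epsilon[of "\<bar>(\<integral>s. f s \<partial>M) - (\<integral>s. f s \<partial>N)\<bar>" 0] by simp
qed

text \<open>Continuous ramps lead from integrals of continuous functions to distribution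
  functions.\<close>

lemma ramp_tendsto_indicator:
  "(\<lambda>n. max 0 (min 1 (1 - real n * (y - x)))) \<longlonglongrightarrow> indicator {..x} y"
proof (cases "y \<le> x")
  case True
  then have "max 0 (min 1 (1 - real n * (y - x))) = 1" for n
    by (simp add: max_def min_def mult_le_0_iff)
  with True show ?thesis by simp
next
  case False
  have "\<forall>\<^sub>F n in sequentially. 1 / (y - x) \<le> real n" by real_asymp
  then have "\<forall>\<^sub>F n in sequentially. max 0 (min 1 (1 - real n * (y - x))) = 0"
    using False by (auto elim!: eventually_mono simp: max_def min_def field_simps)
  with False show ?thesis by (simp add: tendsto_eventually)
qed

text \<open>The traces of half-lines form an intersection-stable generator. Their measures are, by
  dominated convergence, limits of integrals of ramps, which agree for both measures.\<close>

lemma hausdorff_moment_unique: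
  assumes M: "finite_measure M" "sets M = sets (restrict_space borel {0..1::real})"
    and N: "finite_measure N" "sets N = sets (restrict_space borel {0..1})"
    and moments: "\<And>m. (\<integral>s. s ^ m \<partial>M) = (\<integral>s. s ^ m \<partial>N)"
  shows "M = N"
proof (rule measure_eqI_generator_eq[where E = "range (\<lambda>x. {0..1} \<inter> {..x})" and \<Omega> = "{0..1}" and A = "\<lambda>_. {0..1}"])
  interpret M: finite_measure M by fact
  interpret N: finite_measure N by fact
  have gen: "sets (restrict_space borel {0..1::real}) = sigma_sets {0..1} (range (\<lambda>x. {0..1} \<inter> {..x}))"
  proof -
    have "sets (restrict_space borel {0..1::real}) = (\<inter>) {0..1} ` sigma_sets UNIV (range (\<lambda>x. {..x}))"
      by (simp add: sets_restrict_space borel_eq_atMost)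
    also have "\<dots> = sigma_sets {0..1} ((\<inter>) {0..1} ` range (\<lambda>x. {..x}))"
    proof (rule sigma_sets_Int)
      have "{0..1::real} \<in> sets borel" by simp
      then show "{0..1::real} \<in> sigma_sets UNIV (range (\<lambda>x. {..x}))"
        unfolding borel_eq_atMost by simp
    qed simp
    finally show ?thesis by (simp only: image_image)
  qed
  show "sets M = sigma_sets {0..1} (range (\<lambda>x. {0..1} \<inter> {..x}))"
    "sets N = sigma_sets {0..1} (range (\<lambda>x. {0..1} \<inter> {..x}))"
    using M N gen by simp_all
  have measure_eq: "(\<lambda>n. \<integral>y. max 0 (min 1 (1 - real n * (y - x))) \<partial>L) \<longlonglongrightarrow> measure L ({0..1} \<inter> {..x})"
    if L: "finite_measure L" "sets L = sets (restrict_space borel {0..1})" for L x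
  proof -
    interpret L: finite_measure L by fact
    have sp: "space L = {0..1}" using sets_eq_imp_space_eq[OF L(2)] by (simp add: space_restrict_space)
    have mem: "{0..1} \<inter> {..x} \<in> sets L" unfolding L(2) gen by auto
    have "(\<lambda>n. \<integral>y. max 0 (min 1 (1 - real n * (y - x))) \<partial>L) \<longlonglongrightarrow> (\<integral>y. indicator ({0..1} \<inter> {..x}) y \<partial>L)"
    proof (rule integral_dominated_convergence[where w = "\<lambda>_. 1"])
      show "indicator ({0..1} \<inter> {..x}) \<in> borel_measurable L" using mem by measurable
      show "(\<lambda>y. max 0 (min 1 (1 - real n * (y - x)))) \<in> borel_measurable L" for n
        using integrable_unit_interval[OF L] by (intro borel_measurable_integrable) (auto intro!: continuous_intros)
      show "AE y in L. (\<lambda>n. max 0 (min 1 (1 - real n * (y - x)))) \<longlonglongrightarrow> indicator ({0..1} \<inter> {..x}) y"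
      proof (rule AE_I2)
        fix y assume "y \<in> space L"
        then have "indicator ({0..1} \<inter> {..x}) y = (indicator {..x} y :: real)" by (simp add: sp indicator_def)
        then show "(\<lambda>n. max 0 (min 1 (1 - real n * (y - x)))) \<longlonglongrightarrow> indicator ({0..1} \<inter> {..x}) y"
          using ramp_tendsto_indicator[of y x] by simp
      qed
    qed auto
    then show ?thesis using mem by simp
  qed
  fix X assume "X \<in> range (\<lambda>x. {0..1::real} \<inter> {..x})"
  then obtain x where X: "X = {0..1} \<inter> {..x}" by blast
  have "(\<integral>y. max 0 (min 1 (1 - real n * (y - x))) \<partial>M) = (\<integral>y. max 0 (min 1 (1 - real n * (y - x))) \<partial>N)" for n
    by (rule moments_determine_integral[OF M N moments]) (intro continuous_intros)
  then have "measure M X = measure N X"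
    unfolding X using measure_eq[OF M, of x] measure_eq[OF N, of x] by (simp only: LIMSEQ_unique)
  then show "emeasure M X = emeasure N X" by (simp add: M.emeasure_eq_measure N.emeasure_eq_measure)
next
  interpret M: finite_measure M by fact
  show "Int_stable (range (\<lambda>x. {0..1::real} \<inter> {..x}))"
  proof (rule Int_stableI)
    fix a b assume "a \<in> range (\<lambda>x. {0..1::real} \<inter> {..x})" "b \<in> range (\<lambda>x. {0..1::real} \<inter> {..x})"
    then obtain x y where "a = {0..1} \<inter> {..x}" "b = {0..1} \<inter> {..y}" by blast
    then have "a \<inter> b = {0..1} \<inter> {..min x y}" by auto
    then show "a \<inter> b \<in> range (\<lambda>x. {0..1} \<inter> {..x})" by blast
  qed
  show "range (\<lambda>_. {0..1}) \<subseteq> range (\<lambda>x. {0..1::real} \<inter> {..x})"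
  proof -
    have "{0..1} = {0..1::real} \<inter> {..1}" by auto
    then show ?thesis by blast
  qed
  show "emeasure M {0..1} \<noteq> \<infinity>" by simp
qed auto

section \<open>Representing measures and their inverse moments\<close>

lemma represents_moment:
  assumes "represents \<tau> a"
  shows "(\<integral>s. s ^ m \<partial>\<tau>) = a (Suc m) - a m"
proof -
  have \<tau>: "finite_measure \<tau>" "sets \<tau> = sets (restrict_space borel {0..1})"
    and eq: "\<And>n. n \<ge> 1 \<Longrightarrow> a n = a 0 + (\<integral>s. (\<Sum>i<n. s ^ i) \<partial>\<tau>)"
    using assms by (auto simp: represents_def)
  \<comment> \<open>Including \<open>n = 0\<close>, where the sum is empty, allows consecutive
    identities to be subtracted for every \<open>m\<close>.\<close>
  have eq': "a n = a 0 + (\<Sum>i<n. \<integral>s. s ^ i \<partial>\<tau>)" for n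
  proof (cases "n \<ge> 1")
    case True
    have "(\<integral>s. (\<Sum>i<n. s ^ i) \<partial>\<tau>) = (\<Sum>i<n. \<integral>s. s ^ i \<partial>\<tau>)"
      by (intro Bochner_Integration.integral_sum integrable_unit_interval[OF \<tau>] continuous_intros)
    then show ?thesis using eq[OF True] by simp
  qed (simp add: not_le)
  show ?thesis using eq'[of m] eq'[of "Suc m"] by simp
qed

lemma represents_unique: "represents \<tau> a \<Longrightarrow> represents \<tau>' a \<Longrightarrow> \<tau> = \<tau>'"
  using hausdorff_moment_unique[of \<tau> \<tau>'] represents_moment[of \<tau> a] represents_moment[of \<tau>' a]
  by (auto simp: represents_def)

lemma represents_exists:
  assumes "completely_alternating a"
  obtains \<tau> where "represents \<tau> a"
proof -
  have pos: "altdiff n (\<lambda>i. a (Suc i) - a i) m \<ge> 0" for n m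
    using assms by (simp add: altdiff_differences completely_alternating_altdiff)
  obtain \<tau> where \<tau>: "finite_measure \<tau>" "sets \<tau> = sets (restrict_space borel {0..1::real})"
      and moment: "\<And>m. (\<integral>s. s ^ m \<partial>\<tau>) = a (Suc m) - a m"
    using hausdorff_moment[OF pos] by blast
  have "a n = a 0 + (\<integral>s. (\<Sum>i<n. s ^ i) \<partial>\<tau>)" for n
  proof -
    have "(\<integral>s. (\<Sum>i<n. s ^ i) \<partial>\<tau>) = (\<Sum>i<n. \<integral>s. s ^ i \<partial>\<tau>)"
      by (intro Bochner_Integration.integral_sum integrable_unit_interval[OF \<tau>] continuous_intros)
    also have "\<dots> = a n - a 0" unfolding moment by (rule sum_lessThan_telescope)
    finally show ?thesis by simp
  qed
  with \<tau> have "represents \<tau> a" unfolding represents_def by blast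
  then show ?thesis by (rule that)
qed

lemma represents_representing_measure:
  assumes "completely_alternating a"
  shows "represents (representing_measure a) a"
  unfolding representing_measure_def
  using represents_exists[OF assms] represents_unique[of _ a] by (metis theI)

text \<open>A factor \<open>1 - s\<close> in the integrand subtracts the next moment, that is, takes
  one more difference.\<close>

lemma represents_altdiff:
  assumes "represents \<tau> a"
  shows "(\<integral>s. s ^ m * (1 - s) ^ n \<partial>\<tau>) = - altdiff (Suc n) a m"
proof -
  have \<tau>: "finite_measure \<tau>" "sets \<tau> = sets (restrict_space borel {0..1})"
    using assms by (auto simp: represents_def)
  have "(\<integral>s. s ^ m * (1 - s) ^ n \<partial>\<tau>) = altdiff n (\<lambda>i. a (Suc i) - a i) m"
  proof (induction n arbitrary: m)
    case (Suc n)
    have "(\<integral>s. s ^ m * (1 - s) ^ Suc n \<partial>\<tau>) = (\<integral>s. s ^ m * (1 - s) ^ n - s ^ Suc m * (1 - s) ^ n \<partial>\<tau>)"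
      by (simp add: algebra_simps)
    also have "\<dots> = (\<integral>s. s ^ m * (1 - s) ^ n \<partial>\<tau>) - (\<integral>s. s ^ Suc m * (1 - s) ^ n \<partial>\<tau>)"
      by (intro Bochner_Integration.integral_diff integrable_unit_interval[OF \<tau>] continuous_intros)
    finally show ?case unfolding Suc altdiff_Suc .
  qed (simp add: represents_moment[OF assms])
  then show ?thesis by (simp add: altdiff_differences)
qed

text \<open>Multiplying by \<open>1 / s\<close> replaces the powers of \<open>1 - s\<close> by tails
  of the geometric series, and the hockey-stick identity then raises the binomials. At
  \<open>s = 0\<close> both sides are infinite.\<close>

lemma negative_binomial_series:
  assumes s: "0 \<le> s" "s \<le> 1"
  shows "(\<Sum>i. of_nat ((i + k) choose k) * ennreal ((1 - s) ^ i)) = 1 / ennreal s ^ Suc k"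
proof -
  have geometric: "(\<Sum>i. ennreal ((1 - s) ^ i)) = 1 / ennreal s"
  proof (cases "s = 0")
    case True
    then show ?thesis
      using nn_integral_count_space_nat[of "\<lambda>_. 1"] by (simp add: ennreal_divide_zero)
  next
    case False
    then have "(\<lambda>i. (1 - s) ^ i) sums (1 / (1 - (1 - s)))" using s by (intro geometric_sums) auto
    then have "(\<Sum>i. ennreal ((1 - s) ^ i)) = ennreal (1 / s)" using s by (intro suminf_ennreal_eq) auto
    then show ?thesis using False s by (simp add: divide_ennreal flip: ennreal_1)
  qed
  have "(\<Sum>i. of_nat ((i + k) choose k) * ennreal ((1 - s) ^ i)) = (1 / ennreal s) ^ Suc k"
  proof (induction k)
    case (Suc k)
    have "(\<Sum>j. ennreal ((1 - s) ^ (i + j))) = ennreal ((1 - s) ^ i) * (1 / ennreal s)" for i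
      using s by (simp only: power_add ennreal_mult zero_le_power diff_ge_0_iff_ge ennreal_suminf_cmult geometric)
    then have "(\<Sum>i. of_nat ((i + Suc k) choose Suc k) * ennreal ((1 - s) ^ i)) =
        (\<Sum>i. of_nat ((i + k) choose k) * ennreal ((1 - s) ^ i) * (1 / ennreal s))"
      by (simp only: suminf_hockey_stick mult.assoc)
    also have "\<dots> = (1 / ennreal s) ^ Suc k * (1 / ennreal s)"
      by (simp only: ennreal_suminf_multc Suc)
    finally show ?case by (simp only: power_Suc mult.commute)
  qed (simp add: geometric)
  also have "\<dots> = 1 / ennreal s ^ Suc k"
  proof (cases "s = 0")
    case False
    then have inv: "1 / ennreal r = ennreal (1 / r)" if "r > 0" for r
      using divide_ennreal[of 1 r] that by simp
    have "s > 0" using False s by simp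
    then show ?thesis by (simp only: inv ennreal_power zero_less_power zero_le_divide_1_iff less_imp_le power_one_over)
  qed (simp add: ennreal_divide_zero ennreal_power)
  finally show ?thesis .
qed

text \<open>The binomial series has nonnegative terms, so it may be integrated term by term even
  when the result is infinite.\<close>

lemma nn_integral_inverse_power:
  assumes "represents \<tau> a"
  shows "(\<integral>\<^sup>+s. 1 / ennreal s ^ Suc k \<partial>\<tau>) = inv_moment a k"
proof -
  have \<tau>: "finite_measure \<tau>" "sets \<tau> = sets (restrict_space borel {0..1})"
    using assms by (auto simp: represents_def)
  have sp: "space \<tau> = {0..1}" using sets_eq_imp_space_eq[OF \<tau>(2)] by (simp add: space_restrict_space)
  have int: "integrable \<tau> (\<lambda>s. (1 - s) ^ i)" for i
    by (intro integrable_unit_interval[OF \<tau>] continuous_intros)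
  have meas: "(\<lambda>s. ennreal ((1 - s) ^ i)) \<in> borel_measurable \<tau>" for i
    using borel_measurable_integrable[OF int[of i]] by measurable
  have "(\<integral>\<^sup>+s. 1 / ennreal s ^ Suc k \<partial>\<tau>) = (\<integral>\<^sup>+s. (\<Sum>i. of_nat ((i + k) choose k) * ennreal ((1 - s) ^ i)) \<partial>\<tau>)"
    by (intro nn_integral_cong) (auto simp: sp negative_binomial_series)
  also have "\<dots> = (\<Sum>i. of_nat ((i + k) choose k) * (\<integral>\<^sup>+s. ennreal ((1 - s) ^ i) \<partial>\<tau>))"
    using meas by (simp add: nn_integral_suminf nn_integral_cmult)
  also have "\<dots> = inv_moment a k"
    unfolding inv_moment_def
  proof (intro suminf_cong arg_cong2[where f = "(*)"] refl)
    fix i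
    have "(\<integral>\<^sup>+s. ennreal ((1 - s) ^ i) \<partial>\<tau>) = ennreal (\<integral>s. (1 - s) ^ i \<partial>\<tau>)"
      using int by (intro nn_integral_eq_integral) (auto simp: sp)
    then show "(\<integral>\<^sup>+s. ennreal ((1 - s) ^ i) \<partial>\<tau>) = ennreal (- altdiff (Suc i) a 0)"
      using represents_altdiff[OF assms, of 0 i] by simp
  qed
  finally show ?thesis .
qed

subsection \<open>Weighted shifts on directed trees\<close>

lemma infsum_ennreal_if_has_sum:
  fixes f :: "'i \<Rightarrow> real"
  assumes "(f has_sum S) A" "\<And>x. x \<in> A \<Longrightarrow> f x \<ge> 0"
  shows "(\<Sum>\<^sub>\<infinity>x\<in>A. ennreal (f x)) = ennreal S"
proof (rule infsumI)
  have "((\<lambda>F. ennreal (sum f F)) \<longlongrightarrow> ennreal S) (finite_subsets_at_top A)"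
    using assms(1) unfolding has_sum_def by (rule tendsto_ennrealI)
  moreover have "\<forall>\<^sub>F F in finite_subsets_at_top A. ennreal (sum f F) = (\<Sum>x\<in>F. ennreal (f x))"
    using assms(2) by (intro eventually_finite_subsets_at_top_weakI) (metis subsetD sum_ennreal)
  ultimately show "((\<lambda>x. ennreal (f x)) has_sum ennreal S) A"
    unfolding has_sum_def by (simp add: tendsto_cong)
qed

text \<open>Both sums are suprema of finite partial sums, and suprema commute.\<close>

lemma infsum_suminf_ennreal:
  fixes g :: "'i \<Rightarrow> nat \<Rightarrow> ennreal"
  shows "(\<Sum>\<^sub>\<infinity>x\<in>A. \<Sum>i. g x i) = (\<Sum>i. \<Sum>\<^sub>\<infinity>x\<in>A. g x i)"
proof -
  let ?\<F> = "{F. finite F \<and> F \<subseteq> A}"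
  have sup: "(\<Sum>\<^sub>\<infinity>x\<in>A. f x) = (SUP F\<in>?\<F>. sum f F)" for f :: "'i \<Rightarrow> ennreal"
    by (intro nonneg_infsum_complete) simp
  have finite_part: "(\<Sum>\<^sub>\<infinity>x\<in>A. \<Sum>i<n. g x i) = (\<Sum>i<n. \<Sum>\<^sub>\<infinity>x\<in>A. g x i)" for n
  proof (induction n)
    case (Suc n)
    then show ?case
      using infsum_add[OF nonneg_summable_on_complete nonneg_summable_on_complete,
          of A "\<lambda>x. \<Sum>i<n. g x i" "\<lambda>x. g x n"] by simp
  qed simp
  have "(\<Sum>\<^sub>\<infinity>x\<in>A. \<Sum>i. g x i) = (SUP F\<in>?\<F>. \<Sum>i. \<Sum>x\<in>F. g x i)"
    unfolding sup by (simp add: suminf_sum)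
  also have "\<dots> = (SUP n. SUP F\<in>?\<F>. \<Sum>i<n. \<Sum>x\<in>F. g x i)"
    unfolding suminf_eq_SUP by (rule SUP_commute)
  also have "\<dots> = (SUP n. SUP F\<in>?\<F>. \<Sum>x\<in>F. \<Sum>i<n. g x i)"
    by (subst sum.swap) (rule refl)
  also have "\<dots> = (SUP n. \<Sum>\<^sub>\<infinity>x\<in>A. \<Sum>i<n. g x i)"
    unfolding sup ..
  also have "\<dots> = (\<Sum>i. \<Sum>\<^sub>\<infinity>x\<in>A. g x i)"
    unfolding suminf_eq_SUP finite_part ..
  finally show ?thesis .
qed

section \<open>Ancestors and descendants\<close>

context directed_tree
begin

lemma edge_in_V: "(u, v) \<in> E \<Longrightarrow> u \<in> V \<and> v \<in> V"
  using edges by auto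

lemma nonroots_iff: "v \<in> nonroots V E \<longleftrightarrow> (\<exists>u. (u, v) \<in> E)"
  using edge_in_V by (auto simp: nonroots_def is_root_def)

lemma Chi_iff: "v \<in> Chi V E u \<longleftrightarrow> (u, v) \<in> E"
  using edge_in_V by (auto simp: Chi_def)

lemma edge_unique: "(u, v) \<in> E \<Longrightarrow> (u', v) \<in> E \<Longrightarrow> u = u'"
  using unique_parent[of v] edge_in_V by (auto simp: is_root_def)

lemma par_eq: "(u, v) \<in> E \<Longrightarrow> par E v = u"
  unfolding par_def using edge_unique by blast

lemma edge_par_iff: "(u, v) \<in> E \<longleftrightarrow> v \<in> nonroots V E \<and> u = par E v"
  using par_eq nonroots_iff by metis

lemma par_in_V: "v \<in> nonroots V E \<Longrightarrow> par E v \<in> V"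
  using edge_in_V edge_par_iff by blast

lemma par_pow_defined_Suc:
  "par_pow_defined V E (Suc n) v \<longleftrightarrow> v \<in> nonroots V E \<and> par_pow_defined V E n (par E v)"
  unfolding par_pow_defined_def All_less_Suc2 by (simp add: funpow_Suc_right del: funpow.simps)

text \<open>Replaces partial powers of the parent function by \<open>E\<^sup>*\<close>, which allows
  induction from either end of a path.\<close>

lemma ancestor_iff:
  assumes "v \<in> V"
  shows "(u, v) \<in> E\<^sup>* \<longleftrightarrow> (\<exists>n. par_pow_defined V E n v \<and> (par E ^^ n) v = u)"
proof
  assume "(u, v) \<in> E\<^sup>*"
  then show "\<exists>n. par_pow_defined V E n v \<and> (par E ^^ n) v = u"
  proof (induction rule: rtrancl_induct)
    case base
    show ?case by (rule exI[of _ 0]) (simp add: par_pow_defined_def)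
  next
    case (step y z)
    then obtain n where "par_pow_defined V E n y" "(par E ^^ n) y = u" by blast
    with step(2) show ?case
      by (intro exI[of _ "Suc n"])
         (simp add: par_pow_defined_Suc edge_par_iff funpow_Suc_right del: funpow.simps)
  qed
next
  have "par_pow_defined V E n v \<Longrightarrow> ((par E ^^ n) v, v) \<in> E\<^sup>*" for n
  proof (induction n arbitrary: v)
    case (Suc n)
    then have "(par E v, v) \<in> E" "((par E ^^ n) (par E v), par E v) \<in> E\<^sup>*"
      by (auto simp: par_pow_defined_Suc edge_par_iff)
    then show ?case by (simp add: funpow_Suc_right del: funpow.simps)
  qed simp
  then show "\<exists>n. par_pow_defined V E n v \<and> (par E ^^ n) v = u \<Longrightarrow> (u, v) \<in> E\<^sup>*" by blast
qed

lemma Des_iff: "v \<in> Des V E u \<longleftrightarrow> v \<in> V \<and> (u, v) \<in> E\<^sup>*"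
  by (auto simp: Des_def ancestor_iff)

text \<open>\<open>no_circuit\<close> excludes only circuits with distinct vertices, so a shortest
  return to \<open>x\<close> along the parents is chosen.\<close>

lemma acyclic: "(x, x) \<notin> E\<^sup>+"
proof
  assume "(x, x) \<in> E\<^sup>+"
  then obtain z where z: "(x, z) \<in> E\<^sup>*" "(z, x) \<in> E" by (meson tranclD2)
  then have xV: "x \<in> V" "z \<in> V" using edge_in_V by auto
  obtain m where "par_pow_defined V E m z" "(par E ^^ m) z = x"
    using z ancestor_iff[OF xV(2)] by blast
  then have "par_pow_defined V E (Suc m) x \<and> (par E ^^ Suc m) x = x"
    using z(2) by (simp add: par_pow_defined_Suc edge_par_iff funpow_Suc_right del: funpow.simps)
  then have ex: "\<exists>m. par_pow_defined V E (Suc m) x \<and> (par E ^^ Suc m) x = x" by blast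
  define p where "p j = (par E ^^ j) x" for j
  define m where "m = (LEAST m. par_pow_defined V E (Suc m) x \<and> p (Suc m) = x)"
  have m: "par_pow_defined V E (Suc m) x" "p (Suc m) = x"
    using LeastI_ex[OF ex] unfolding m_def p_def by auto
  have least: "p (Suc i) \<noteq> x" if "i < m" for i
    using not_less_Least[OF that[unfolded m_def]] m(1) that
    by (auto simp: p_def par_pow_defined_def)
  have edge: "(p (Suc j), p j) \<in> E" if "j \<le> m" for j
    using m(1) that by (auto simp: par_pow_defined_def p_def edge_par_iff)
  \<comment> \<open>Cutting out a repetition would give an earlier return to
    \<open>x\<close>.\<close>
  have inj: "p i \<noteq> p j" if "i < j" "j \<le> m" for i j
  proof
    assume eq: "p i = p j"
    have "p (i + k) = p (j + k)" for k
      by (induction k) (use eq in \<open>auto simp: p_def\<close>)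
    from this[of "Suc m - j"] that m(2) have "p (Suc (i + (m - j))) = x" by (simp add: Suc_diff_le)
    with least[of "i + (m - j)"] that show False by simp
  qed
  have "m \<noteq> 0"
    using edge[of 0] m(2) edges by (auto simp: p_def)
  \<comment> \<open>Reversed, because edges lead from \<open>p (Suc j)\<close> to
    \<open>p j\<close>.\<close>
  define us where "us = map (\<lambda>i. p (m - i)) [0..<Suc m]"
  have "length us \<ge> 2" using \<open>m \<noteq> 0\<close> by (simp add: us_def)
  moreover have "distinct us"
  proof -
    have "p (m - i) \<noteq> p (m - j)" if "i < j" "j \<le> m" for i j
      using inj[of "m - j" "m - i"] that by (simp add: eq_commute)
    then have "inj_on (\<lambda>i. p (m - i)) {0..<Suc m}"
      by (intro inj_onI) (metis atLeastLessThan_iff less_Suc_eq_le linorder_neqE_nat)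
    then show ?thesis unfolding us_def by (simp only: distinct_map distinct_upt set_upt)
  qed
  moreover have "successively (\<lambda>x y. (x, y) \<in> E) us"
    unfolding successively_conv_nth
  proof (intro allI impI)
    fix i assume "Suc i < length us"
    then have "i < m" by (simp add: us_def)
    then have "us ! i = p (Suc (m - Suc i))" "us ! Suc i = p (m - Suc i)"
      by (simp_all add: us_def Suc_diff_Suc del: upt_Suc)
    then show "(us ! i, us ! Suc i) \<in> E" using edge[of "m - Suc i"] by simp
  qed
  moreover have "(last us, hd us) \<in> E"
  proof -
    have "last us = x" by (simp add: us_def p_def)
    moreover have "hd us = p m" by (simp add: us_def upt_conv_Cons del: upt_Suc)
    ultimately show ?thesis using edge[of m] m(2) by simp
  qed
  ultimately show False using no_circuit by blast
qed

end

section \<open>Squared norms under powers of a weighted shift\<close>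

lemma l2_norm_sq_has_sum:
  assumes "f \<in> l2 W"
  shows "((\<lambda>v. (cmod (f v))\<^sup>2) has_sum (l2_norm W f)\<^sup>2) W"
  using assms by (simp add: l2_def l2_norm_def infsum_nonneg)

lemma unit_vec_in_l2: "u \<in> W \<Longrightarrow> unit_vec u \<in> l2 W"
  unfolding l2_def unit_vec_def
  by (auto simp: indicator_def intro!: finite_nonzero_values_imp_summable_on
        finite_subset[of "{v \<in> W. _ v \<noteq> 0}" "{u}"] split: if_splits)

locale tree_shift = directed_tree V E for V :: "'a set" and E +
  fixes lam :: "'a \<Rightarrow> complex"
  assumes bounded: "weighted_shift V E lam \<in> bounded_operators V"
begin

abbreviation "S \<equiv> shift_map V E lam"
abbreviation "norm_seq \<equiv> norm_sq_seq V (weighted_shift V E lam)"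
abbreviation "a \<equiv> shift_seq V E lam"

lemma S_in_l2: "h \<in> l2 V \<Longrightarrow> S h \<in> l2 V"
  using bounded by (auto simp: bounded_operators_def weighted_shift_def)

lemma S_funpow_in_l2: "h \<in> l2 V \<Longrightarrow> (S ^^ n) h \<in> l2 V"
  by (induction n) (auto intro: S_in_l2)

lemma norm_seq_has_sum:
  "h \<in> l2 V \<Longrightarrow> ((\<lambda>v. (cmod ((S ^^ n) h v))\<^sup>2) has_sum norm_seq h n) V"
  unfolding norm_sq_seq_def weighted_shift_def snd_conv
  by (intro l2_norm_sq_has_sum S_funpow_in_l2)

lemma norm_seq_Suc: "norm_seq h (Suc n) = norm_seq (S h) n"
  by (simp add: norm_sq_seq_def weighted_shift_def funpow_swap1)

lemma a_nonneg: "a u n \<ge> 0"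
  by (simp add: shift_seq_def norm_sq_seq_def)

lemma a_0 [simp]:
  assumes "u \<in> V"
  shows "a u 0 = 1"
proof -
  have "((\<lambda>v. (cmod (unit_vec u v))\<^sup>2) has_sum a u 0) V"
    using norm_seq_has_sum[OF unit_vec_in_l2[OF assms], of 0] by (simp add: shift_seq_def)
  moreover have "((\<lambda>v. (cmod (unit_vec u v))\<^sup>2) has_sum 1) V \<longleftrightarrow> ((\<lambda>v. 1 :: real) has_sum 1) {u}"
    using assms by (intro has_sum_cong_neutral) (auto simp: unit_vec_def)
  moreover have "((\<lambda>v. 1 :: real) has_sum 1) {u}" by (rule has_sum_finiteI) simp_all
  ultimately show ?thesis using has_sum_unique by blast
qed

text \<open>The expansion at \<open>n\<close> is a hypothesis because its own inductive proof uses
  this recursion to reach \<open>Suc n\<close>.\<close>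

lemma shift_seq_Suc_if:
  assumes "\<And>h. h \<in> l2 V \<Longrightarrow> ((\<lambda>u. (cmod (h u))\<^sup>2 * a u n) has_sum norm_seq h n) V" and "u \<in> V"
  shows "((\<lambda>v. (cmod (lam v))\<^sup>2 * a v n) has_sum a u (Suc n)) (Chi V E u)"
proof -
  have "((\<lambda>v. (cmod (S (unit_vec u) v))\<^sup>2 * a v n) has_sum a u (Suc n)) V"
    using assms(1)[OF S_in_l2[OF unit_vec_in_l2[OF assms(2)]]] by (simp add: shift_seq_def norm_seq_Suc)
  moreover have "S (unit_vec u) v = (if v \<in> Chi V E u then lam v else 0)" for v
    by (auto simp: shift_map_def unit_vec_def indicator_def Chi_iff edge_par_iff)
  ultimately have "((\<lambda>v. (cmod (if v \<in> Chi V E u then lam v else 0))\<^sup>2 * a v n) has_sum a u (Suc n)) V"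
    by simp
  also have "?this \<longleftrightarrow> ?thesis"
    by (intro has_sum_cong_neutral) (auto simp: Chi_def)
  finally show ?thesis .
qed

text \<open>Parents are unique, so images of different basis vectors have disjoint supports. The
  first application of the shift is split off, and the induction hypothesis is applied to
  \<open>S h\<close>.\<close>

lemma norm_seq_expansion:
  "h \<in> l2 V \<Longrightarrow> ((\<lambda>u. (cmod (h u))\<^sup>2 * a u n) has_sum norm_seq h n) V"
proof (induction n arbitrary: h)
  case 0
  have "((\<lambda>u. (cmod (h u))\<^sup>2) has_sum norm_seq h 0) V" using norm_seq_has_sum[OF 0, of 0] by simp
  then show ?case by (rule has_sum_cong[THEN iffD1, rotated]) simp
next
  case (Suc n)
  have "((\<lambda>v. (cmod (S h v))\<^sup>2 * a v n) has_sum norm_seq h (Suc n)) V"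
    using Suc.IH[OF S_in_l2[OF Suc.prems]] by (simp add: norm_seq_Suc)
  also have "?this \<longleftrightarrow> ((\<lambda>v. (cmod (S h v))\<^sup>2 * a v n) has_sum norm_seq h (Suc n)) (nonroots V E)"
    by (intro has_sum_cong_neutral) (auto simp: shift_map_def nonroots_def)
  \<comment> \<open>Every nonroot is the lower end of exactly one edge; grouping the edges by parent
    makes \<open>a u (Suc n)\<close> the inner sum.\<close>
  also have "\<dots> \<longleftrightarrow> ((\<lambda>(u, v). (cmod (h u))\<^sup>2 * ((cmod (lam v))\<^sup>2 * a v n)) has_sum norm_seq h (Suc n)) (Sigma V (Chi V E))"
    by (rule has_sum_reindex_bij_witness[where i = snd and j = "\<lambda>v. (par E v, v)"])
       (auto simp: Chi_iff edge_par_iff shift_map_def norm_mult power_mult_distrib par_in_V)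
  finally show ?case
    by (rule has_sum_SigmaD)
       (auto intro!: has_sum_cmult_right shift_seq_Suc_if[OF Suc.IH])
qed

lemma shift_seq_Suc:
  "u \<in> V \<Longrightarrow> ((\<lambda>v. (cmod (lam v))\<^sup>2 * a v n) has_sum a u (Suc n)) (Chi V E u)"
  by (rule shift_seq_Suc_if) (rule norm_seq_expansion)

text \<open>The set \<open>W\<close> serves the whole tree and the subtree below omega at
  once.\<close>

lemma completely_alternating_norm_seq_iff:
  assumes "W \<subseteq> V"
  shows "(\<forall>h\<in>l2 V. (\<forall>v. v \<notin> W \<longrightarrow> h v = 0) \<longrightarrow> completely_alternating (norm_seq h)) \<longleftrightarrow>
    (\<forall>u\<in>W. completely_alternating (a u))"
proof (intro iffI ballI impI)
  fix u assume *: "\<forall>h\<in>l2 V. (\<forall>v. v \<notin> W \<longrightarrow> h v = 0) \<longrightarrow> completely_alternating (norm_seq h)" "u \<in> W"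
  have "unit_vec u \<in> l2 V" using assms *(2) by (auto intro: unit_vec_in_l2)
  moreover have "unit_vec u v = 0" if "v \<notin> W" for v
    using *(2) that by (auto simp: unit_vec_def indicator_def)
  ultimately show "completely_alternating (a u)"
    unfolding shift_seq_def by (intro *(1)[rule_format])
next
  fix h assume ca: "\<forall>u\<in>W. completely_alternating (a u)" and h: "h \<in> l2 V" "\<forall>v. v \<notin> W \<longrightarrow> h v = 0"
  show "completely_alternating (norm_seq h)"
    unfolding completely_alternating_altdiff
  proof (intro allI)
    fix m n
    have "((\<lambda>u. (cmod (h u))\<^sup>2 * altdiff (Suc n) (a u) m) has_sum altdiff (Suc n) (norm_seq h) m) V"
      by (intro altdiff_has_sum norm_seq_expansion h)
    moreover have "(cmod (h u))\<^sup>2 * altdiff (Suc n) (a u) m \<le> 0" for u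
      using h(2) ca by (cases "u \<in> W") (auto simp: completely_alternating_altdiff mult_le_0_iff)
    ultimately show "altdiff (Suc n) (norm_seq h) m \<le> 0"
      by (rule has_sum_mono[OF _ has_sum_0_simp])
  qed
qed

lemma completely_hyperexpansive_iff:
  "completely_hyperexpansive V (weighted_shift V E lam) \<longleftrightarrow> (\<forall>u\<in>V. completely_alternating (a u))"
  using bounded completely_alternating_norm_seq_iff[OF subset_refl]
  by (auto simp: completely_hyperexpansive_def l2_def)

lemma isometry_iff: "isometry V (weighted_shift V E lam) \<longleftrightarrow> (\<forall>u\<in>V. a u 1 = 1)"
proof -
  have iso: "l2_norm V (snd (weighted_shift V E lam) h) = l2_norm V h \<longleftrightarrow> norm_seq h 1 = norm_seq h 0" for h
    by (auto simp: norm_sq_seq_def l2_norm_def infsum_nonneg)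
  show ?thesis
  proof
    assume "isometry V (weighted_shift V E lam)"
    then have "a u 1 = a u 0" if "u \<in> V" for u
      using unit_vec_in_l2[OF that] by (simp only: isometry_def iso shift_seq_def)
    then show "\<forall>u\<in>V. a u 1 = 1" by simp
  next
    assume a1: "\<forall>u\<in>V. a u 1 = 1"
    have "norm_seq h 1 = norm_seq h 0" if h: "h \<in> l2 V" for h
    proof (rule has_sum_unique)
      show "((\<lambda>u. (cmod (h u))\<^sup>2 * a u 1) has_sum norm_seq h 1) V" by (rule norm_seq_expansion[OF h])
      show "((\<lambda>u. (cmod (h u))\<^sup>2 * a u 1) has_sum norm_seq h 0) V"
        using norm_seq_expansion[OF h, of 0] by (rule has_sum_cong[THEN iffD1, rotated]) (simp add: a1[simplified])
    qed
    then show "isometry V (weighted_shift V E lam)" using bounded by (simp only: isometry_def iso) simp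
  qed
qed

lemma isometry_imp_completely_hyperexpansive:
  assumes "isometry V (weighted_shift V E lam)"
  shows "completely_hyperexpansive V (weighted_shift V E lam)"
proof -
  have step: "norm_seq h (Suc n) = norm_seq h n" if "h \<in> l2 V" for h n
    using assms S_funpow_in_l2[OF that, of n]
    by (simp add: isometry_def norm_sq_seq_def weighted_shift_def)
  have "altdiff (Suc n) (norm_seq h) m = 0" if "h \<in> l2 V" for h n m
    by (induction n arbitrary: m) (simp_all add: altdiff_Suc step[OF that])
  then show ?thesis
    using bounded by (simp add: completely_hyperexpansive_def completely_alternating_altdiff)
qed

text \<open>The sequence at \<open>u\<close> without its first term is the weighted sum of those at
  the children. Their complete alternation supplies the measures and makes all terms nonnegative, so
  the sum over children and the series over \<open>i\<close> can be interchanged.\<close>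

lemma moment_sum_eq:
  assumes u: "u \<in> V" and ca: "\<And>v. v \<in> Chi V E u \<Longrightarrow> completely_alternating (a v)"
  shows "moment_sum V E lam u (Suc k) = inv_moment (\<lambda>n. a u (Suc n)) k"
proof -
  let ?b = "\<lambda>n. a u (Suc n)" and ?w = "\<lambda>i. real ((i + k) choose k)"
  let ?t = "\<lambda>v i. (cmod (lam v))\<^sup>2 * - altdiff (Suc i) (a v) 0"
  have "moment_sum V E lam u (Suc k) = (\<Sum>\<^sub>\<infinity>v\<in>Chi V E u. ennreal ((cmod (lam v))\<^sup>2) * inv_moment (a v) k)"
    unfolding moment_sum_def tau_def
    by (intro infsum_cong arg_cong2[where f = "(*)"] refl nn_integral_inverse_power
        represents_representing_measure ca)
  also have "\<dots> = (\<Sum>\<^sub>\<infinity>v\<in>Chi V E u. \<Sum>i. ennreal (?w i * ?t v i))"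
  proof (intro infsum_cong)
    fix v
    have "ennreal ((cmod (lam v))\<^sup>2) * (of_nat ((i + k) choose k) * ennreal (- altdiff (Suc i) (a v) 0))
        = ennreal (?w i * ?t v i)" for i
      by (simp only: ennreal_mult' zero_le_power2 of_nat_0_le_iff ennreal_of_nat_eq_real_of_nat mult.left_commute)
    then show "ennreal ((cmod (lam v))\<^sup>2) * inv_moment (a v) k = (\<Sum>i. ennreal (?w i * ?t v i))"
      unfolding inv_moment_def ennreal_suminf_cmult[symmetric] by simp
  qed
  also have "\<dots> = (\<Sum>i. \<Sum>\<^sub>\<infinity>v\<in>Chi V E u. ennreal (?w i * ?t v i))"
    by (rule infsum_suminf_ennreal)
  also have "\<dots> = inv_moment ?b k"
    unfolding inv_moment_def
  proof (rule suminf_cong)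
    fix i
    have "((\<lambda>v. (cmod (lam v))\<^sup>2 * altdiff (Suc i) (a v) 0) has_sum altdiff (Suc i) ?b 0) (Chi V E u)"
      using shift_seq_Suc[OF u] by (intro altdiff_has_sum)
    then have "((\<lambda>v. ?w i * ?t v i) has_sum ?w i * - altdiff (Suc i) ?b 0) (Chi V E u)"
      by (intro has_sum_cmult_right) (simp add: has_sum_uminus)
    then have "(\<Sum>\<^sub>\<infinity>v\<in>Chi V E u. ennreal (?w i * ?t v i)) = ennreal (?w i * - altdiff (Suc i) ?b 0)"
      using ca by (intro infsum_ennreal_if_has_sum)
        (auto simp: completely_alternating_altdiff mult_nonneg_nonpos intro!: mult_nonneg_nonneg)
    then show "(\<Sum>\<^sub>\<infinity>v\<in>Chi V E u. ennreal (?w i * ?t v i)) =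
        of_nat ((i + k) choose k) * ennreal (- altdiff (Suc i) ?b 0)"
      by (simp only: ennreal_mult' of_nat_0_le_iff ennreal_of_nat_eq_real_of_nat)
  qed
  finally show ?thesis .
qed

text \<open>In the subtree omega becomes a root, but nothing is lost: \<open>f\<close> vanishes off
  the descendants.\<close>

lemma Des_shift_map:
  assumes "\<And>v. v \<notin> Des V E \<omega> \<Longrightarrow> f v = 0"
  shows "shift_map (Des V E \<omega>) (Des_edges V E \<omega>) lam f = S f"
proof
  fix v
  have nonroots: "w \<in> nonroots (Des V E \<omega>) (Des_edges V E \<omega>) \<longleftrightarrow> (\<exists>u. (u, w) \<in> Des_edges V E \<omega>)" for w
    by (auto simp: nonroots_def is_root_def Des_edges_def)
  have "par E w = par (Des_edges V E \<omega>) w" if "(u, w) \<in> Des_edges V E \<omega>" for u w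
  proof -
    have "par (Des_edges V E \<omega>) w = u"
      unfolding par_def using that edge_unique by (intro the_equality) (auto simp: Des_edges_def)
    then show ?thesis using that par_eq by (simp add: Des_edges_def)
  qed
  \<comment> \<open>Covers omega as well as the vertices outside the subtree.\<close>
  moreover have "S f v = 0" if no: "\<nexists>u. (u, v) \<in> Des_edges V E \<omega>"
  proof (cases "v \<in> nonroots V E")
    case True
    then have e: "(par E v, v) \<in> E" by (simp add: edge_par_iff)
    have "par E v \<notin> Des V E \<omega>"
    proof
      assume "par E v \<in> Des V E \<omega>"
      moreover from this have "v \<in> Des V E \<omega>"
        using e edge_in_V by (auto simp: Des_iff)
      ultimately show False using no e by (auto simp: Des_edges_def)
    qed
    then show ?thesis by (simp add: shift_map_def assms)
  qed (simp add: shift_map_def)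
  moreover have "v \<in> nonroots V E" if "(u, v) \<in> Des_edges V E \<omega>" for u
    using that by (auto simp: Des_edges_def nonroots_iff)
  ultimately show "shift_map (Des V E \<omega>) (Des_edges V E \<omega>) lam f v = S f v"
    unfolding shift_map_def[of "Des V E \<omega>"] nonroots by (auto simp: shift_map_def)
qed

text \<open>The functions vanishing off the descendants form a subspace invariant under
  \<open>S\<close>, with the same norm. The basis vectors can therefore be tested with the sequences
  of the whole tree.\<close>

lemma completely_hyperexpansive_Des_iff:
  "completely_hyperexpansive (Des V E \<omega>) (weighted_shift (Des V E \<omega>) (Des_edges V E \<omega>) lam) \<longleftrightarrow>
    (\<forall>u\<in>Des V E \<omega>. completely_alternating (a u))"
proof -
  let ?D = "Des V E \<omega>"
  let ?T = "shift_map ?D (Des_edges V E \<omega>) lam"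
  have sub: "?D \<subseteq> V" by (auto simp: Des_def)
  have norm: "l2_norm ?D f = l2_norm V f" if "\<And>v. v \<notin> ?D \<Longrightarrow> f v = 0" for f
    unfolding l2_norm_def using sub that by (intro arg_cong[of _ _ sqrt] infsum_cong_neutral) auto
  have l2: "f \<in> l2 ?D \<longleftrightarrow> f \<in> l2 V \<and> (\<forall>v. v \<notin> ?D \<longrightarrow> f v = 0)" for f
  proof -
    have "(\<lambda>v. (cmod (f v))\<^sup>2) summable_on ?D \<longleftrightarrow> (\<lambda>v. (cmod (f v))\<^sup>2) summable_on V"
      if "\<And>v. v \<notin> ?D \<Longrightarrow> f v = 0"
      using sub that by (intro summable_on_cong_neutral) auto
    then show ?thesis using sub unfolding l2_def by blast
  qed
  have T: "?T f = S f" if "f \<in> l2 ?D" for f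
    using that by (intro Des_shift_map) (auto simp: l2_def)
  have S_off: "?T f v = 0" if "v \<notin> ?D" for f v
    using that by (simp add: shift_map_def nonroots_def)
  have T_l2: "?T f \<in> l2 ?D" if "f \<in> l2 ?D" for f
    using S_off[of _ f] S_in_l2 T[OF that] that unfolding l2 by simp
  have T_pow: "(?T ^^ n) f = (S ^^ n) f \<and> (?T ^^ n) f \<in> l2 ?D" if "f \<in> l2 ?D" for f n
    by (induction n) (use that T T_l2 in auto)
  have dom: "weighted_shift ?D (Des_edges V E \<omega>) lam = (l2 ?D, ?T)"
    using T_l2 by (auto simp: weighted_shift_def)
  have "norm_sq_seq ?D (weighted_shift ?D (Des_edges V E \<omega>) lam) f n = norm_seq f n" if "f \<in> l2 ?D" for f n
    using norm[of "(S ^^ n) f"] T_pow[OF that, of n] unfolding l2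
    by (auto simp: norm_sq_seq_def weighted_shift_def)
  then have seq: "norm_sq_seq ?D (weighted_shift ?D (Des_edges V E \<omega>) lam) f = norm_seq f" if "f \<in> l2 ?D" for f
    using that by blast
  obtain C where C: "\<And>f. f \<in> l2 V \<Longrightarrow> l2_norm V (S f) \<le> C * l2_norm V f"
  proof -
    have "\<exists>C. \<forall>f. f \<in> l2 V \<and> S f \<in> l2 V \<longrightarrow> l2_norm V (S f) \<le> C * l2_norm V f"
      using bounded by (simp add: bounded_operators_def weighted_shift_def)
    then show ?thesis using that S_in_l2 by blast
  qed
  have "l2_norm ?D (?T f) \<le> C * l2_norm ?D f" if "f \<in> l2 ?D" for f
    using C[of f] T_l2[OF that] T[OF that] that norm[of f] norm[of "?T f"] unfolding l2 by simp
  then have "weighted_shift ?D (Des_edges V E \<omega>) lam \<in> bounded_operators ?D"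
    using T_l2 unfolding dom bounded_operators_def
    by (auto simp: shift_map_def fun_eq_iff algebra_simps intro!: exI[of _ C])
  then show ?thesis
    unfolding completely_hyperexpansive_def completely_alternating_norm_seq_iff[OF sub, symmetric]
    using seq l2 by auto
qed

end

subsection \<open>Trees with one branching vertex\<close>

locale branching_tree_shift = tree_shift V E lam
  for V :: "'a set" and E and lam :: "'a \<Rightarrow> complex" +
  fixes \<omega> :: 'a
  assumes omega: "\<omega> \<in> V"
    and nonbranching: "\<And>v. v \<in> V - {\<omega>} \<Longrightarrow> card (Chi V E v) = 1"
    and nonzero: "\<And>v. v \<in> nonroots V E \<Longrightarrow> lam v \<noteq> 0"
begin

lemma only_child:
  assumes "(u, v) \<in> E" "u \<noteq> \<omega>"
  shows "Chi V E u = {v}"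
proof -
  have "card (Chi V E u) = 1" using assms edge_in_V by (intro nonbranching) auto
  moreover have "v \<in> Chi V E u" using assms(1) by (simp add: Chi_iff)
  ultimately show ?thesis by (metis card_1_singletonE singletonD)
qed

lemma weight_pos:
  assumes "(u, v) \<in> E"
  shows "(cmod (lam v))\<^sup>2 > 0"
proof -
  have "v \<in> nonroots V E" using assms unfolding nonroots_iff by blast
  then show ?thesis using nonzero by simp
qed

text \<open>Comparability with omega survives each edge of an undirected path: upwards because
  parents are unique, downwards because a proper ancestor of omega has only one child.\<close>

lemma ancestor_or_descendant:
  assumes "x \<in> V"
  shows "(x, \<omega>) \<in> E\<^sup>* \<or> (\<omega>, x) \<in> E\<^sup>*"
proof (cases "x = \<omega>")
  case False
  obtain vs where vs: "length vs \<ge> 2" "hd vs = \<omega>" "last vs = x"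
      "successively (\<lambda>x y. (x, y) \<in> E \<or> (y, x) \<in> E) vs"
    using connected[OF omega assms False[symmetric]] by blast
  let ?Q = "\<lambda>x. (x, \<omega>) \<in> E\<^sup>* \<or> (\<omega>, x) \<in> E\<^sup>*"
  have up: "?Q z" if "?Q y" "(z, y) \<in> E" for y z
  proof (cases "(y, \<omega>) \<in> E\<^sup>*")
    case True
    with that(2) show ?thesis by (blast intro: converse_rtrancl_into_rtrancl)
  next
    case False
    with that(1) have "(\<omega>, y) \<in> E\<^sup>*" "\<omega> \<noteq> y" by blast+
    then obtain w where "(\<omega>, w) \<in> E\<^sup>*" "(w, y) \<in> E" by (metis rtranclE)
    then show ?thesis using edge_unique[OF _ that(2)] by blast
  qed
  have down: "?Q z" if "?Q y" "(y, z) \<in> E" for y z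
  proof (cases "(\<omega>, y) \<in> E\<^sup>*")
    case True
    with that(2) show ?thesis by (blast intro: rtrancl_into_rtrancl)
  next
    case False
    with that(1) have "(y, \<omega>) \<in> E\<^sup>*" "y \<noteq> \<omega>" by blast+
    then obtain w where w: "(y, w) \<in> E" "(w, \<omega>) \<in> E\<^sup>*" by (metis converse_rtranclE)
    have "z = w"
      using only_child[OF w(1) \<open>y \<noteq> \<omega>\<close>] only_child[OF that(2) \<open>y \<noteq> \<omega>\<close>] by simp
    with w show ?thesis by blast
  qed
  have "successively (\<lambda>x y. (x, y) \<in> E \<or> (y, x) \<in> E) vs \<Longrightarrow> vs \<noteq> [] \<Longrightarrow> ?Q (hd vs) \<Longrightarrow> ?Q (last vs)" for vs
  proof (induction vs rule: induct_list012)
    case (3 y z zs)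
    have "(y, z) \<in> E \<or> (z, y) \<in> E" "?Q y"
      using "3.prems" by simp_all
    then have "?Q z" using up down by blast
    with "3.IH"(2) "3.prems" show ?case by simp
  qed simp_all
  from this[OF vs(4)] vs(1-3) show ?thesis by (cases vs) auto
qed simp

lemma shift_seq_only_child:
  assumes "(u, v) \<in> E" "u \<noteq> \<omega>"
  shows "a u = case_nat 1 (\<lambda>n. (cmod (lam v))\<^sup>2 * a v n)"
proof
  fix n
  have uV: "u \<in> V" using assms edge_in_V by blast
  show "a u n = case_nat 1 (\<lambda>n. (cmod (lam v))\<^sup>2 * a v n) n"
  proof (cases n)
    case (Suc m)
    have "((\<lambda>v. (cmod (lam v))\<^sup>2 * a v m) has_sum a u (Suc m)) {v}"
      using shift_seq_Suc[OF uV] only_child[OF assms] by simp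
    then have "a u (Suc m) = (cmod (lam v))\<^sup>2 * a v m"
      by (rule has_sum_unique) (rule has_sum_finiteI, simp_all)
    then show ?thesis using Suc by simp
  qed (simp add: uV)
qed

text \<open>Dropping the leading term and dividing by a positive weight preserve complete
  alternation.\<close>

lemma completely_alternating_only_child:
  assumes "(u, v) \<in> E" "u \<noteq> \<omega>" "completely_alternating (a u)"
  shows "completely_alternating (a v)"
  using completely_alternating_shift[OF assms(3), of 1] weight_pos[OF assms(1)]
  by (simp add: shift_seq_only_child[OF assms(1,2)] completely_alternating_scale)

text \<open>By acyclicity a path down from a child of omega never meets omega again, so each of its
  edges leads to an only child.\<close>

lemma completely_alternating_descendant:
  assumes "v \<in> Chi V E \<omega>" "completely_alternating (a v)" "(v, w) \<in> E\<^sup>*"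
  shows "completely_alternating (a w)"
  using assms(3)
proof (induction rule: rtrancl_induct)
  case (step y z)
  have "(\<omega>, y) \<in> E\<^sup>+" using assms(1) step(1) by (auto simp: Chi_iff)
  then have "y \<noteq> \<omega>" using acyclic by blast
  with step show ?case using completely_alternating_only_child by blast
qed (rule assms(2))

lemma completely_alternating_between:
  assumes "(r, u) \<in> E\<^sup>*" "completely_alternating (a r)" "(u, \<omega>) \<in> E\<^sup>*"
  shows "completely_alternating (a u)"
  using assms(1,3)
proof (induction rule: rtrancl_induct)
  case (step y z)
  then have "(y, \<omega>) \<in> E\<^sup>+" by auto
  then have "y \<noteq> \<omega>" using acyclic by blast
  moreover have "completely_alternating (a y)"
    using step by (meson converse_rtrancl_into_rtrancl)
  ultimately show ?case using step(2) completely_alternating_only_child by blast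
qed (rule assms(2))

lemma completely_alternating_Des_iff:
  "(\<forall>u\<in>Des V E \<omega>. completely_alternating (a u)) \<longleftrightarrow>
    completely_alternating (a \<omega>) \<and> (\<forall>v\<in>Chi V E \<omega>. completely_alternating (a v))"
proof -
  have "\<omega> \<in> Des V E \<omega>" "Chi V E \<omega> \<subseteq> Des V E \<omega>"
    using omega edge_in_V by (auto simp: Des_iff Chi_iff)
  moreover have "u = \<omega> \<or> (\<exists>v\<in>Chi V E \<omega>. (v, u) \<in> E\<^sup>*)" if "u \<in> Des V E \<omega>" for u
    using that unfolding Des_iff Chi_iff Bex_def by (metis converse_rtranclE)
  ultimately show ?thesis
    using completely_alternating_descendant by blast
qed

lemma hyperexpansive_iff_ancestors:
  "completely_hyperexpansive V (weighted_shift V E lam) \<longleftrightarrow>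
    (\<forall>u. (u, \<omega>) \<in> E\<^sup>* \<longrightarrow> completely_alternating (a u)) \<and> (\<forall>v\<in>Chi V E \<omega>. completely_alternating (a v))"
proof -
  have "u \<in> V" if "(u, \<omega>) \<in> E\<^sup>*" for u
    using that omega edge_in_V by (auto elim: converse_rtranclE)
  moreover have "u \<in> Des V E \<omega> \<or> (u, \<omega>) \<in> E\<^sup>*" if "u \<in> V" for u
    using that ancestor_or_descendant by (auto simp: Des_iff)
  moreover have "Des V E \<omega> \<subseteq> V" by (auto simp: Des_iff)
  ultimately show ?thesis
    unfolding completely_hyperexpansive_iff using completely_alternating_Des_iff by blast
qed

definition "b n = a \<omega> (Suc n)"

lemma shift_seq_omega: "a \<omega> = case_nat 1 b"
  by (rule ext) (auto simp: b_def omega split: nat.split)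

lemma b_0: "(\<Sum>\<^sub>\<infinity>v\<in>Chi V E \<omega>. ennreal ((cmod (lam v))\<^sup>2)) = ennreal (b 0)"
proof (rule infsum_ennreal_if_has_sum)
  show "((\<lambda>v. (cmod (lam v))\<^sup>2) has_sum b 0) (Chi V E \<omega>)"
    using shift_seq_Suc[OF omega, of 0] unfolding b_def
    by (rule has_sum_cong[THEN iffD1, rotated]) (simp add: Chi_def)
qed simp

lemma moment_sum_omega:
  assumes "\<And>v. v \<in> Chi V E \<omega> \<Longrightarrow> completely_alternating (a v)"
  shows "moment_sum V E lam \<omega> (Suc k) = inv_moment b k"
  using moment_sum_eq[OF omega assms] unfolding b_def[abs_def] by blast

text \<open>\<open>b\<close> inherits complete alternation as a nonnegative combination of the
  children's sequences, so the prepended 1 gives the only condition.\<close>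

lemma completely_alternating_omega_iff:
  assumes ca: "\<forall>v\<in>Chi V E \<omega>. completely_alternating (a v)"
  shows "completely_alternating (a \<omega>) \<longleftrightarrow>
    (\<Sum>\<^sub>\<infinity>v\<in>Chi V E \<omega>. ennreal ((cmod (lam v))\<^sup>2)) \<ge> 1 + moment_sum V E lam \<omega> 1"
proof -
  have "completely_alternating b"
    unfolding completely_alternating_altdiff
  proof (intro allI)
    fix m n
    have "((\<lambda>v. (cmod (lam v))\<^sup>2 * altdiff (Suc n) (a v) m) has_sum altdiff (Suc n) b m) (Chi V E \<omega>)"
      unfolding b_def using shift_seq_Suc[OF omega] by (intro altdiff_has_sum)
    moreover have "(cmod (lam v))\<^sup>2 * altdiff (Suc n) (a v) m \<le> 0" if "v \<in> Chi V E \<omega>" for v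
      using ca that by (auto simp: completely_alternating_altdiff mult_le_0_iff)
    ultimately show "altdiff (Suc n) b m \<le> 0"
      by (rule has_sum_mono[OF _ has_sum_0_simp])
  qed
  moreover have "b 0 \<ge> 0" by (simp add: b_def a_nonneg)
  ultimately show ?thesis
    using moment_sum_omega[of 0] ca
    unfolding shift_seq_omega by (simp add: completely_alternating_case_nat b_0)
qed

lemma root_ancestor:
  assumes "is_root V E r"
  shows "(r, \<omega>) \<in> E\<^sup>*"
proof -
  have "(r, \<omega>) \<in> E\<^sup>* \<or> (\<omega>, r) \<in> E\<^sup>*"
    using assms by (intro ancestor_or_descendant) (simp add: is_root_def)
  then show ?thesis using assms unfolding is_root_def by (metis rtranclE rtrancl.rtrancl_refl)
qed

lemma is_root_par_pow_unique:
  assumes "par_pow_defined V E m \<omega>" "par_pow_defined V E n \<omega>"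
    "is_root V E ((par E ^^ m) \<omega>)" "is_root V E ((par E ^^ n) \<omega>)"
  shows "m = n"
  using assms by (cases m n rule: linorder_cases) (auto simp: par_pow_defined_def nonroots_def)

text \<open>Every root is an ancestor of omega, and the chain of parents of omega cannot continue
  past a root.\<close>

lemma tree_root_eq:
  assumes "is_root V E r"
  shows "tree_root V E = r"
  unfolding tree_root_def
proof (rule the_equality)
  show "is_root V E r" by (rule assms)
  fix r' assume "is_root V E r'"
  then show "r' = r"
    using assms root_ancestor ancestor_iff[OF omega] is_root_par_pow_unique by metis
qed

lemma root_dist_omega:
  assumes "is_root V E r" "\<omega> \<noteq> r"
  shows "root_dist V E \<omega> \<ge> 1" "par_pow_defined V E (root_dist V E \<omega>) \<omega>"
    "(par E ^^ root_dist V E \<omega>) \<omega> = r"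
proof -
  obtain k where k: "par_pow_defined V E k \<omega>" "(par E ^^ k) \<omega> = r"
    using root_ancestor[OF assms(1)] ancestor_iff[OF omega] by blast
  moreover have "k \<ge> 1" using k(2) assms(2) by (cases k) auto
  moreover have "root_dist V E \<omega> = k"
    unfolding root_dist_def tree_root_eq[OF assms(1)]
    using k \<open>k \<ge> 1\<close> assms(1) by (intro the_equality) (auto intro: is_root_par_pow_unique)
  ultimately show "root_dist V E \<omega> \<ge> 1" "par_pow_defined V E (root_dist V E \<omega>) \<omega>"
    "(par E ^^ root_dist V E \<omega>) \<omega> = r" by auto
qed

theorem omega_root:
  assumes "is_root V E \<omega>"
  shows "completely_hyperexpansive V (weighted_shift V E lam) \<longleftrightarrow>
    (\<forall>v\<in>Chi V E \<omega>. completely_alternating (a v)) \<and>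
    (\<Sum>\<^sub>\<infinity>v\<in>Chi V E \<omega>. ennreal ((cmod (lam v))\<^sup>2)) \<ge> 1 + moment_sum V E lam \<omega> 1"
proof -
  have "(u, \<omega>) \<in> E\<^sup>* \<longleftrightarrow> u = \<omega>" for u
    using assms unfolding is_root_def by (metis rtranclE rtrancl.rtrancl_refl)
  then show ?thesis
    unfolding hyperexpansive_iff_ancestors using completely_alternating_omega_iff by auto
qed

theorem rootless:
  assumes "\<not> has_root V E"
  shows "completely_hyperexpansive V (weighted_shift V E lam) \<longleftrightarrow> isometry V (weighted_shift V E lam)"
proof
  assume "completely_hyperexpansive V (weighted_shift V E lam)"
  then have ca: "completely_alternating (a u)" if "u \<in> V" for u
    using that by (simp add: completely_hyperexpansive_iff)
  have nonroot: "u \<in> nonroots V E" if "u \<in> V" for u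
    using assms that by (auto simp: nonroots_def has_root_def)
  have ancestors: "a u n = 1" if u: "(u, \<omega>) \<in> E\<^sup>*" for u n
  proof -
    define p where "p k = (par E ^^ k) u" for k
    have "u \<in> V" using u omega edge_in_V by (auto elim: converse_rtranclE)
    then have pV: "p k \<in> V" for k by (induction k) (auto simp: p_def nonroot par_in_V)
    have edge: "(p (Suc k), p k) \<in> E" for k
      using nonroot[OF pV[of k]] by (simp add: edge_par_iff p_def)
    have "(p (Suc k), \<omega>) \<in> E\<^sup>+" for k
    proof (induction k)
      case 0
      then show ?case using edge[of 0] u by (auto simp: p_def)
    next
      case (Suc k)
      then show ?case using edge[of "Suc k"] by (rule trancl_into_trancl2[rotated])
    qed
    \<comment> \<open>The chain may start at omega but never returns to it, so every edge of it
      leads to an only child.\<close>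
    then have neq: "p (Suc k) \<noteq> \<omega>" for k using acyclic by metis
    have "a (p 0) n = 1"
    proof (rule infinite_backward_extensions_const[where x = "\<lambda>k. a (p k)" and l = "\<lambda>k. (cmod (lam (p (k - 1))))\<^sup>2"])
      show "a (p (Suc k)) = case_nat 1 (\<lambda>n. (cmod (lam (p (Suc k - 1))))\<^sup>2 * a (p k) n)" for k
        using shift_seq_only_child[OF edge neq] by simp
      show "(cmod (lam (p (k - 1))))\<^sup>2 > 0" for k using weight_pos[OF edge] .
    qed (use pV ca in auto)
    then show ?thesis by (simp add: p_def)
  qed
  have descendants: "\<forall>n. a u n = 1" if "(\<omega>, u) \<in> E\<^sup>*" for u
    using that
  proof (induction rule: rtrancl_induct)
    case base
    then show ?case using ancestors by simp
  next
    case (step u v)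
    have V: "u \<in> V" "v \<in> V" using step(2) edge_in_V by auto
    have "a v (Suc n) = a v n" for n
    proof -
      let ?f = "\<lambda>v. (cmod (lam v))\<^sup>2 * (a v (Suc n) - a v n)"
      have "((\<lambda>v. (cmod (lam v))\<^sup>2 * a v (Suc n) + - ((cmod (lam v))\<^sup>2 * a v n)) has_sum
          a u (Suc (Suc n)) + - a u (Suc n)) (Chi V E u)"
        by (intro has_sum_add has_sum_uminusI shift_seq_Suc V)
      \<comment> \<open>The weighted increments at the children add up to an increment at
        \<open>u\<close>, which is 0; being nonnegative, each of them vanishes.\<close>
      then have total: "(?f has_sum 0) (Chi V E u)" using step.IH by (simp add: algebra_simps)
      have single: "(?f has_sum ?f v) {v}" by (rule has_sum_finiteI) simp_all
      have nonneg: "?f w \<ge> 0" if "w \<in> Chi V E u" for w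
        using that ca completely_alternating_incseq[of "a w" n] by (simp add: Chi_def)
      have "?f v \<le> 0"
      proof (rule has_sum_mono'[OF single total])
        show "{v} \<subseteq> Chi V E u" using step(2) by (simp add: Chi_iff)
      qed (rule nonneg, blast)
      then have "a v (Suc n) \<le> a v n"
        using weight_pos[OF step(2)] by (simp add: mult_le_0_iff)
      then show ?thesis using completely_alternating_incseq[OF ca[OF V(2)], of n] by simp
    qed
    then have "a v n = 1" for n by (induction n) (simp_all add: V)
    then show ?case by blast
  qed
  show "isometry V (weighted_shift V E lam)"
    unfolding isometry_iff using ancestors descendants ancestor_or_descendant by blast
qed (rule isometry_imp_completely_hyperexpansive)

end

section \<open>The case of a root different from omega\<close>

locale branching_tree_shift_root = branching_tree_shift V E lam \<omega>
  for V :: "'a set" and E and lam :: "'a \<Rightarrow> complex" and \<omega> +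
  fixes r
  assumes root: "is_root V E r" and neq: "\<omega> \<noteq> r"
begin

definition "\<kappa> = root_dist V E \<omega>"

text \<open>Since parents are unique, all ancestors of omega lie on the path from the root, and
  complete alternation passes down along it.\<close>

lemma hyperexpansive_iff_root:
  "completely_hyperexpansive V (weighted_shift V E lam) \<longleftrightarrow>
    completely_alternating (a r) \<and> (\<forall>v\<in>Chi V E \<omega>. completely_alternating (a v))"
proof -
  have "(r, u) \<in> E\<^sup>*" if "(u, \<omega>) \<in> E\<^sup>*" for u
    using that
  proof (induction rule: converse_rtrancl_induct)
    case base
    show ?case by (rule root_ancestor[OF root])
  next
    case (step y z)
    have "r \<noteq> z" using root step(1) unfolding is_root_def by blast
    then obtain w where "(r, w) \<in> E\<^sup>*" "(w, z) \<in> E" using step.IH by (metis rtranclE)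
    then show ?case using edge_unique[OF _ step(1)] by blast
  qed
  then show ?thesis
    unfolding hyperexpansive_iff_ancestors
    using completely_alternating_between root_ancestor[OF root] by blast
qed

text \<open>The chain of ancestors ends at the root; beyond \<open>\<kappa>\<close> it is continued with weight 1, because
  \<^locale>\<open>backward_extensions\<close> asks for an infinite chain.\<close>

definition "l k = (if 1 \<le> k \<and> k \<le> \<kappa> then (cmod (lam ((par E ^^ (k - 1)) \<omega>)))\<^sup>2 else 1)"

definition "x = rec_nat (a \<omega>) (\<lambda>k y. case_nat 1 (\<lambda>n. l (Suc k) * y n))"

lemma ancestor_edge: "k < \<kappa> \<Longrightarrow> ((par E ^^ Suc k) \<omega>, (par E ^^ k) \<omega>) \<in> E"
  using root_dist_omega(2)[OF root neq] by (auto simp: \<kappa>_def par_pow_defined_def edge_par_iff)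

lemma ancestor_neq: "k < \<kappa> \<Longrightarrow> (par E ^^ Suc k) \<omega> \<noteq> \<omega>"
proof
  assume "k < \<kappa>" "(par E ^^ Suc k) \<omega> = \<omega>"
  moreover have "((par E ^^ Suc k) \<omega>, \<omega>) \<in> E\<^sup>+" if "k < \<kappa>" for k
    using that
  proof (induction k)
    case 0
    then show ?case using ancestor_edge[of 0] by auto
  next
    case (Suc k)
    then show ?case using ancestor_edge[of "Suc k"] by (auto intro: trancl_into_trancl2)
  qed
  ultimately show False using acyclic by metis
qed

lemma x_eq: "k \<le> \<kappa> \<Longrightarrow> x k = a ((par E ^^ k) \<omega>)"
proof (induction k)
  case (Suc k)
  then have "a ((par E ^^ Suc k) \<omega>) = case_nat 1 (\<lambda>n. (cmod (lam ((par E ^^ k) \<omega>)))\<^sup>2 * a ((par E ^^ k) \<omega>) n)"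
    using ancestor_edge ancestor_neq by (intro shift_seq_only_child) auto
  with Suc show ?case by (simp add: x_def l_def)
qed (simp add: x_def)

lemma prod_l:
  assumes "1 \<le> k" "k \<le> \<kappa>"
  shows "(\<Prod>j=1..k. l j) = (cmod (\<Prod>j=0..k - 1. lam ((par E ^^ j) \<omega>)))\<^sup>2"
proof -
  have "(\<Prod>j=1..k. l j) = (\<Prod>j=0..k - 1. (cmod (lam ((par E ^^ j) \<omega>)))\<^sup>2)"
    using assms by (intro prod.reindex_bij_witness[of _ Suc "\<lambda>j. j - 1"]) (auto simp: l_def)
  also have "\<dots> = (cmod (\<Prod>j=0..k - 1. lam ((par E ^^ j) \<omega>)))\<^sup>2"
    by (simp only: prod_norm[symmetric] prod_power_distrib)
  finally show ?thesis .
qed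

sublocale backward_extensions b x l
proof
  show "l k > 0" for k
  proof (cases "1 \<le> k \<and> k \<le> \<kappa>")
    case True
    then have "k - 1 < \<kappa>" by linarith
    from weight_pos[OF ancestor_edge[OF this]] True show ?thesis by (simp add: l_def)
  qed (auto simp: l_def)
  show "x 0 = case_nat 1 b" by (simp add: x_def shift_seq_omega)
  show "b 0 \<ge> 0" by (simp add: b_def a_nonneg)
qed (simp add: x_def)

text \<open>With \<open>\<kappa> = Suc k\<close>, the root's sequence is \<open>x (Suc k)\<close>.
  Its own step gives the inequality, and \<open>balanced k\<close> gives the equalities up to
  \<open>\<kappa> - 1\<close>.\<close>

theorem omega_not_root:
  "completely_hyperexpansive V (weighted_shift V E lam) \<longleftrightarrow>
     completely_hyperexpansive (Des V E \<omega>) (weighted_shift (Des V E \<omega>) (Des_edges V E \<omega>) lam) \<and>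
     (\<Sum>\<^sub>\<infinity>v\<in>Chi V E \<omega>. ennreal ((cmod (lam v))\<^sup>2)) = 1 + moment_sum V E lam \<omega> 1 \<and>
     (\<forall>k. 1 \<le> k \<and> k \<le> \<kappa> - 1 \<longrightarrow>
        ennreal ((cmod (lam ((par E ^^ (k - 1)) \<omega>)))\<^sup>2) =
        1 + ennreal ((cmod (\<Prod>j=0..k-1. lam ((par E ^^ j) \<omega>)))\<^sup>2) * moment_sum V E lam \<omega> (k + 1)) \<and>
     ennreal ((cmod (lam ((par E ^^ (\<kappa> - 1)) \<omega>)))\<^sup>2) \<ge>
       1 + ennreal ((cmod (\<Prod>j=0..\<kappa>-1. lam ((par E ^^ j) \<omega>)))\<^sup>2) * moment_sum V E lam \<omega> (\<kappa> + 1)"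
proof (cases "\<forall>v\<in>Chi V E \<omega>. completely_alternating (a v)")
  case True
  obtain k where k: "\<kappa> = Suc k"
    using root_dist_omega(1)[OF root neq] by (cases \<kappa>) (auto simp: \<kappa>_def)
  have moment: "moment_sum V E lam \<omega> (Suc j) = inv_moment b j" for j
    using True by (intro moment_sum_omega) blast
  have "x \<kappa> = a r" using x_eq[of \<kappa>] root_dist_omega(3)[OF root neq] by (simp add: \<kappa>_def)
  then have "completely_hyperexpansive V (weighted_shift V E lam) \<longleftrightarrow>
      completely_alternating (a \<omega>) \<and> balanced k \<and>
      1 + ennreal (\<Prod>j=1..\<kappa>. l j) * inv_moment b \<kappa> \<le> ennreal (l \<kappa>)"
    using hyperexpansive_iff_root True completely_alternating_x_iff[of k] x_eq[of 0] by (simp add: k)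
  moreover have "completely_alternating (a \<omega>) \<longleftrightarrow>
      completely_hyperexpansive (Des V E \<omega>) (weighted_shift (Des V E \<omega>) (Des_edges V E \<omega>) lam)"
    using True by (simp add: completely_hyperexpansive_Des_iff completely_alternating_Des_iff)
  moreover have "balanced k \<longleftrightarrow>
      (\<Sum>\<^sub>\<infinity>v\<in>Chi V E \<omega>. ennreal ((cmod (lam v))\<^sup>2)) = 1 + moment_sum V E lam \<omega> 1 \<and>
      (\<forall>k. 1 \<le> k \<and> k \<le> \<kappa> - 1 \<longrightarrow>
        ennreal ((cmod (lam ((par E ^^ (k - 1)) \<omega>)))\<^sup>2) =
        1 + ennreal ((cmod (\<Prod>j=0..k-1. lam ((par E ^^ j) \<omega>)))\<^sup>2) * moment_sum V E lam \<omega> (k + 1))"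
  proof -
    have "ennreal (l i) = 1 + ennreal (\<Prod>j=1..i. l j) * inv_moment b i \<longleftrightarrow>
        ennreal ((cmod (lam ((par E ^^ (i - 1)) \<omega>)))\<^sup>2) =
        1 + ennreal ((cmod (\<Prod>j=0..i-1. lam ((par E ^^ j) \<omega>)))\<^sup>2) * moment_sum V E lam \<omega> (i + 1)"
      if "1 \<le> i" "i \<le> k" for i
    proof -
      have "i \<le> \<kappa>" using that k by simp
      with that show ?thesis by (simp only: prod_l moment Suc_eq_plus1[symmetric]) (simp add: l_def)
    qed
    then show ?thesis
      using moment[of 0] unfolding balanced_def b_0 k by auto
  qed
  moreover have "l \<kappa> = (cmod (lam ((par E ^^ (\<kappa> - 1)) \<omega>)))\<^sup>2" by (simp add: l_def k)
  moreover have "(\<Prod>j=1..\<kappa>. l j) = (cmod (\<Prod>j=0..\<kappa>-1. lam ((par E ^^ j) \<omega>)))\<^sup>2"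
    by (rule prod_l) (simp_all add: k)
  ultimately show ?thesis by (simp only: moment Suc_eq_plus1[symmetric] conj_assoc)
next
  \<comment> \<open>Now \<open>moment_sum\<close> may involve unspecified measures, but both sides
    are false: hyperexpansivity on the whole tree and on the subtree each imply complete alternation
    at the children.\<close>
  case False
  then show ?thesis
    unfolding completely_hyperexpansive_Des_iff completely_alternating_Des_iff hyperexpansive_iff_root by blast
qed

end

theorem theorem7p2p1:
  fixes V :: "'a set" and E :: "('a \<times> 'a) set" and \<omega> :: 'a and lam :: "'a \<Rightarrow> complex"
  assumes tree: "directed_tree V E"
    and omega: "\<omega> \<in> V"
    and branching: "infinite (Chi V E \<omega>) \<or> card (Chi V E \<omega>) \<ge> 2"
    and nonbranching: "\<And>v. v \<in> V - {\<omega>} \<Longrightarrow> card (Chi V E v) = 1"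
    and nonzero: "\<And>v. v \<in> nonroots V E \<Longrightarrow> lam v \<noteq> 0"
    and bounded: "weighted_shift V E lam \<in> bounded_operators V"
  shows
    "(has_root V E \<and> \<omega> = tree_root V E \<longrightarrow>
       (completely_hyperexpansive V (weighted_shift V E lam) \<longleftrightarrow>
          (\<forall>v\<in>Chi V E \<omega>. completely_alternating (shift_seq V E lam v)) \<and>
          (\<Sum>\<^sub>\<infinity>v\<in>Chi V E \<omega>. ennreal ((cmod (lam v))\<^sup>2)) \<ge> 1 + moment_sum V E lam \<omega> 1))
     \<and>
     (has_root V E \<and> \<omega> \<noteq> tree_root V E \<longrightarrow>
       (let \<kappa> = root_dist V E \<omega>;
            iia =
              completely_hyperexpansive (Des V E \<omega>)
                (weighted_shift (Des V E \<omega>) (Des_edges V E \<omega>) lam) \<and>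
              (\<Sum>\<^sub>\<infinity>v\<in>Chi V E \<omega>. ennreal ((cmod (lam v))\<^sup>2)) = 1 + moment_sum V E lam \<omega> 1 \<and>
              (\<forall>k. 1 \<le> k \<and> k \<le> \<kappa> - 1 \<longrightarrow>
                 ennreal ((cmod (lam ((par E ^^ (k - 1)) \<omega>)))\<^sup>2) =
                 1 + ennreal ((cmod (\<Prod>j=0..k-1. lam ((par E ^^ j) \<omega>)))\<^sup>2)
                     * moment_sum V E lam \<omega> (k + 1)) \<and>
              ennreal ((cmod (lam ((par E ^^ (\<kappa> - 1)) \<omega>)))\<^sup>2) \<ge>
                1 + ennreal ((cmod (\<Prod>j=0..\<kappa>-1. lam ((par E ^^ j) \<omega>)))\<^sup>2)
                    * moment_sum V E lam \<omega> (\<kappa> + 1);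
            iib =
              completely_alternating (shift_seq V E lam (tree_root V E)) \<and>
              (\<forall>v\<in>Chi V E \<omega>. completely_alternating (shift_seq V E lam v))
        in (completely_hyperexpansive V (weighted_shift V E lam) \<longleftrightarrow> iia) \<and>
           (completely_hyperexpansive V (weighted_shift V E lam) \<longleftrightarrow> iib)))
     \<and>
     (\<not> has_root V E \<longrightarrow>
       (completely_hyperexpansive V (weighted_shift V E lam) \<longleftrightarrow>
          isometry V (weighted_shift V E lam)))"
proof -
  interpret directed_tree V E by (rule tree)
  interpret branching_tree_shift V E lam \<omega>
    using bounded omega nonbranching nonzero by unfold_locales auto
  have root: "is_root V E (tree_root V E)" if "has_root V E"
    using that tree_root_eq by (auto simp: has_root_def)
  show ?thesis
  proof (intro conjI impI, goal_cases)
    case 1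
    then have "is_root V E \<omega>" using root by simp
    then show ?case by (rule omega_root)
  next
    case 2
    then interpret branching_tree_shift_root V E lam \<omega> "tree_root V E"
      using root by unfold_locales auto
    show ?case
      unfolding Let_def
      by (rule conjI[OF omega_not_root[unfolded \<kappa>_def] hyperexpansive_iff_root])
  next
    case 3
    then show ?case by (rule rootless)
  qed
qed

end
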